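(* Let $n\in\mathbb N$, let $X\subseteq P$ be an $n$-admissible set of partitions, and let $p\in P(k,l)$ and $q\in P(k',l')$, where $k,l,k',l'\in\mathbb N_0$. Then: \begin{itemize} \item[(a)] $\mathrm{id}\in H_n(X)$. \item[(b)] If $p,q\in H_n(X)$, then also $p\otimes q\in H_n(X)$. \item[(c)] If $p,q\in H_n(X)$ and $l=k'$, then also $qp\in H_n(X)$. \item[(d)] If $p\in H_n(X)$, then also $\tilde p\in H_n(X)$. \item[(e)] Suppose $\sqcap,\sqcup\in H_n(X)$. If $p\in H_n(X)$, then also $p^*\in H_n(X)$. \end{itemize}
   Context: Partitions. For $k,l\in\mathbb N_0$, $P(k,l)$ is the set of all set partitions (decompositions into disjoint non-empty blocks) of a set of $k+l$ points arranged as an upper row of $k$ points and a lower row of $l$ points, each row ordered from left to right. $P$ is the collection of all $P(k,l)$, $k,l\in\mathbb N_0$. Special partitions: $\mathrm{id}\in P(1,1)$ is the partition with a single block (one upper and one lower point connected); $\sqcap\in P(0,2)$ and $\sqcup\in P(2,0)$ are the partitions consisting of a single block of two points (the pair partitions). Operations. For $p\in P(k,l)$ and $q\in P(k',l')$: the tensor product $p\otimes q\in P(k+k',l+l')$ is obtained by placing $q$ to the right of $p$. If $l=k'$, the composition $qp\in P(k,l')$ is obtained by writing $q$ below $p$ and identifying the $l$ lower points of $p$ with the $k'=l$ upper points of $q$ (from left to right): two points among the upper points of $p$ and the lower points of $q$ are in the same block of $qp$ iff they are connected via the blocks of $p$ and $q$ (passing through middle points); the middle points are then removed, and connected components containing only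 middle points are discarded. The vertical reflection $\tilde p\in P(k,l)$ is obtained by reversing the left-to-right order of both rows. The involution $p^*\in P(l,k)$ is obtained by turning $p$ upside down, i.e. exchanging the upper and the lower row, keeping left-to-right order. Relations. Let $n\in\mathbb N$. For $p\in P(k,l)$ and multi indices $i=(i_1,\dots,i_k)$, $j=(j_1,\dots,j_l)$ with entries in $\{1,\dots,n\}$, label the upper points of $p$ from left to right by $i_1,\dots,i_k$ and the lower points from left to right by $j_1,\dots,j_l$; put $\delta_p(i,j)=1$ if any two points in the same block of $p$ carry equal labels, and $\delta_p(i,j)=0$ otherwise. Let $A$ be a unital $C^*$-algebra generated by elements $u_{ij}$, $1\le i,j\le n$. The $u_{ij}$ fulfill the relations $R(p)$ if all $u_{ij}$ are self-adjoint and for all $\alpha_1,\dots,\alpha_k,\beta_1,\dots,\beta_l\in\{1,\dots,n\}$ $$\sum_{\gamma_1,\ldots,\gamma_k=1}^n \delta_p(\gamma,\beta)\, u_{\gamma_1\alpha_1}\cdots u_{\gamma_k\alpha_k}=\sum_{\gamma_1',\ldots,\gamma_l'=1}^n \delta_p(\alpha,\gamma')\, u_{\beta_1\gamma_1'}\cdots u_{\beta_l\gamma_l'},$$ where for $k=0$ the left-hand side is read as $\delta_p(\emptyset,\beta)1$ and for $l=0$ the right-hand side is read as $\delta_p(\alpha,\emptyset)1$. Partition $C^*$-algebras. A set $X\subseteq P$ is $n$-admissible if the unital universal $C^*$-algebra $$A_n(X):=C^*(1,u_{ij},\ i,j=1,\dots,n\mid u_{ij}=u_{ij}^*,\ \text{the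 relations } R(p)\text{ hold for all }p\in X)$$ exists, i.e. if the supremum of all $C^*$-seminorms on the universal unital $*$-algebra with these generators and relations is finite on each element. For $n$-admissible $X$, $H_n(X)$ denotes the set of all partitions $p\in P$ such that the relations $R(p)$ are fulfilled by the generators $u_{ij}$ of $A_n(X)$. *)

theory Defs
  imports
    Complex_Main
    "HOL-Algebra.QuotRing"
    "HOL-Algebra.Module"
    "HOL-Library.Disjoint_Sets"
    "HOL-Library.Poly_Mapping"
begin

section \<open>Partitions\<close>

text \<open>Points in each row are numbered from left to right, starting with 0.\<close>

datatype point = Up nat | Lo nat

definition points :: "nat \<Rightarrow> nat \<Rightarrow> point set" where
  "points k l = Up ` {..<k} \<union> Lo ` {..<l}"

text \<open>A partition is represented by its set of blocks; as the union of the blocks is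
  \<^term>\<open>points k l\<close>, the numbers \<^term>\<open>k\<close> and \<^term>\<open>l\<close> can be recovered from it.\<close>

definition Part :: "nat \<Rightarrow> nat \<Rightarrow> point set set set" where
  "Part k l = {p. partition_on (points k l) p}"

definition Partitions :: "point set set set" where
  "Partitions = (\<Union>k l. Part k l)"

definition id_part :: "point set set" where
  "id_part = {{Up 0, Lo 0}}"

definition cap_part :: "point set set" where
  "cap_part = {{Lo 0, Lo 1}}"

definition cup_part :: "point set set" where
  "cup_part = {{Up 0, Up 1}}"

fun shift :: "nat \<Rightarrow> nat \<Rightarrow> point \<Rightarrow> point" where
  "shift k l (Up a) = Up (k + a)"
| "shift k l (Lo b) = Lo (l + b)"

text \<open>\<open>tensor_part k l p q\<close> is the tensor product of \<open>p \<in> Part k l\<close> and an arbitrary partition \<open>q\<close>.\<close>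

definition tensor_part :: "nat \<Rightarrow> nat \<Rightarrow> point set set \<Rightarrow> point set set \<Rightarrow> point set set" where
  "tensor_part k l p q = p \<union> (`) (shift k l) ` q"

fun reverse :: "nat \<Rightarrow> nat \<Rightarrow> point \<Rightarrow> point" where
  "reverse k l (Up a) = Up (k - 1 - a)"
| "reverse k l (Lo b) = Lo (l - 1 - b)"

definition reflection :: "nat \<Rightarrow> nat \<Rightarrow> point set set \<Rightarrow> point set set" where
  "reflection k l p = (`) (reverse k l) ` p"

fun flip :: "point \<Rightarrow> point" where
  "flip (Up a) = Lo a"
| "flip (Lo b) = Up b"

definition involution :: "point set set \<Rightarrow> point set set" where
  "involution p = (`) flip ` p"

text \<open>For the composition, \<open>q\<close> is drawn below \<open>p\<close>: the lower row of \<open>p\<close> and the upper row of \<open>q\<close>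
  are both identified with the middle one of three rows.\<close>

datatype point3 = Top nat | Mid nat | Bot nat

fun place_above :: "point \<Rightarrow> point3" where
  "place_above (Up a) = Top a"
| "place_above (Lo b) = Mid b"

fun place_below :: "point \<Rightarrow> point3" where
  "place_below (Up a) = Mid a"
| "place_below (Lo b) = Bot b"

fun outer :: "point \<Rightarrow> point3" where
  "outer (Up a) = Top a"
| "outer (Lo b) = Bot b"

definition connected3 :: "point set set \<Rightarrow> point set set \<Rightarrow> (point3 \<times> point3) set" where
  "connected3 q p =
     {(x, y). \<exists>B \<in> (`) place_above ` p \<union> (`) place_below ` q. x \<in> B \<and> y \<in> B}\<^sup>*"

text \<open>\<open>compose_part k m q p\<close> is the composition \<open>qp \<in> Part k m\<close> of \<open>p \<in> Part k l\<close> and \<open>q \<in> Part l m\<close>.\<close>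

definition compose_part :: "nat \<Rightarrow> nat \<Rightarrow> point set set \<Rightarrow> point set set \<Rightarrow> point set set" where
  "compose_part k m q p =
     points k m // {(x, y) \<in> points k m \<times> points k m. (outer x, outer y) \<in> connected3 q p}"


section \<open>Unital star-algebras\<close>

record 'a star_algebra = "(complex, 'a) module" +
  star :: "'a \<Rightarrow> 'a"

record 'a normed_star_algebra = "'a star_algebra" +
  alg_norm :: "'a \<Rightarrow> real"

text \<open>Scalar multiplication on the quotient by an ideal \<open>J\<close>: \<open>J + cK\<close> is the coset of \<open>cx\<close> for
  every \<open>x \<in> K\<close>, also when \<open>c = 0\<close>. The image of a coset under the star is again a coset
  if \<open>J\<close> is closed under the star.\<close>

definition quotient_star_algebra ::
    "('a, 'b) star_algebra_scheme \<Rightarrow> 'a set \<Rightarrow> 'a set star_algebra" where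
  "quotient_star_algebra A J = ring.extend (A Quot J)
     \<lparr>smult = (\<lambda>c K. J <+>\<^bsub>A\<^esub> (smult A c ` K)), star = (\<lambda>K. star A ` K)\<rparr>"

text \<open>The ideal is closed under scalar multiplication because the algebras are unital.\<close>

definition star_ideal_generated :: "('a, 'b) star_algebra_scheme \<Rightarrow> 'a set \<Rightarrow> 'a set" where
  "star_ideal_generated A S = Idl\<^bsub>A\<^esub> (S \<union> star A ` S)"

definition cstar_seminorm :: "('a, 'b) star_algebra_scheme \<Rightarrow> ('a \<Rightarrow> real) \<Rightarrow> bool" where
  "cstar_seminorm A N \<longleftrightarrow>
     (\<forall>x\<in>carrier A. 0 \<le> N x) \<and>
     (\<forall>c. \<forall>x\<in>carrier A. N (c \<odot>\<^bsub>A\<^esub> x) = cmod c * N x) \<and>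
     (\<forall>x\<in>carrier A. \<forall>y\<in>carrier A. N (x \<oplus>\<^bsub>A\<^esub> y) \<le> N x + N y) \<and>
     (\<forall>x\<in>carrier A. \<forall>y\<in>carrier A. N (x \<otimes>\<^bsub>A\<^esub> y) \<le> N x * N y) \<and>
     (\<forall>x\<in>carrier A. N (star A x \<otimes>\<^bsub>A\<^esub> x) = (N x)\<^sup>2)"

definition cstar_seminorms_bounded :: "('a, 'b) star_algebra_scheme \<Rightarrow> bool" where
  "cstar_seminorms_bounded A \<longleftrightarrow>
     (\<forall>x\<in>carrier A. bdd_above {N x | N. cstar_seminorm A N})"

definition max_cstar_seminorm :: "('a, 'b) star_algebra_scheme \<Rightarrow> 'a \<Rightarrow> real" where
  "max_cstar_seminorm A x = Sup {N x | N. cstar_seminorm A N}"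

text \<open>The Hausdorff completion of \<open>A\<close> with respect to a seminorm \<open>N\<close>: Cauchy sequences
  modulo null sequences.\<close>

definition cauchy_star_algebra ::
    "('a, 'b) star_algebra_scheme \<Rightarrow> ('a \<Rightarrow> real) \<Rightarrow> (nat \<Rightarrow> 'a) star_algebra" where
  "cauchy_star_algebra A N =
     \<lparr>carrier = {x. (\<forall>i. x i \<in> carrier A) \<and>
         (\<forall>e>0. \<exists>M. \<forall>i\<ge>M. \<forall>j\<ge>M. N (x i \<ominus>\<^bsub>A\<^esub> x j) < e)},
      mult = (\<lambda>x y i. x i \<otimes>\<^bsub>A\<^esub> y i), one = (\<lambda>i. \<one>\<^bsub>A\<^esub>),
      zero = (\<lambda>i. \<zero>\<^bsub>A\<^esub>), add = (\<lambda>x y i. x i \<oplus>\<^bsub>A\<^esub> y i),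
      smult = (\<lambda>c x i. c \<odot>\<^bsub>A\<^esub> x i), star = (\<lambda>x i. star A (x i))\<rparr>"

definition null_sequences ::
    "('a, 'b) star_algebra_scheme \<Rightarrow> ('a \<Rightarrow> real) \<Rightarrow> (nat \<Rightarrow> 'a) set" where
  "null_sequences A N =
     {x \<in> carrier (cauchy_star_algebra A N). (\<lambda>i. N (x i)) \<longlonglongrightarrow> 0}"

definition completion ::
    "('a, 'b) star_algebra_scheme \<Rightarrow> ('a \<Rightarrow> real) \<Rightarrow> (nat \<Rightarrow> 'a) set normed_star_algebra" where
  "completion A N = star_algebra.extend
     (quotient_star_algebra (cauchy_star_algebra A N) (null_sequences A N))
     \<lparr>alg_norm = (\<lambda>K. THE r. \<forall>x\<in>K. (\<lambda>i. N (x i)) \<longlonglongrightarrow> r)\<rparr>"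

definition completion_embed ::
    "('a, 'b) star_algebra_scheme \<Rightarrow> ('a \<Rightarrow> real) \<Rightarrow> 'a \<Rightarrow> (nat \<Rightarrow> 'a) set" where
  "completion_embed A N x = null_sequences A N +>\<^bsub>cauchy_star_algebra A N\<^esub> (\<lambda>i. x)"


section \<open>The free unital star-algebra\<close>

text \<open>\<open>Gen g\<close> stands for the generator \<open>g\<close>, and \<open>Adj g\<close> for its adjoint. The free unital
  star-algebra is the monoid algebra of the free monoid of words in these letters.\<close>

datatype 'g letter = Gen 'g | Adj 'g

datatype 'g word = Word (letters: "'g letter list")

instantiation word :: (type) monoid_add
begin

definition zero_word :: "'a word" where
  "0 = Word []"

definition plus_word :: "'a word \<Rightarrow> 'a word \<Rightarrow> 'a word" where
  "v + w = Word (letters v @ letters w)"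

instance
  by standard (simp_all add: zero_word_def plus_word_def)

end

fun letter_adjoint :: "'g letter \<Rightarrow> 'g letter" where
  "letter_adjoint (Gen g) = Adj g"
| "letter_adjoint (Adj g) = Gen g"

definition word_adjoint :: "'g word \<Rightarrow> 'g word" where
  "word_adjoint w = Word (rev (map letter_adjoint (letters w)))"

definition free_star_algebra :: "'g set \<Rightarrow> ('g word \<Rightarrow>\<^sub>0 complex) star_algebra" where
  "free_star_algebra G =
     \<lparr>carrier = {f. \<forall>w \<in> Poly_Mapping.keys f. set (letters w) \<subseteq> Gen ` G \<union> Adj ` G},
      mult = (*), one = 1, zero = 0, add = (+),
      smult = (\<lambda>c. Poly_Mapping.map ((*) c)),
      star = (\<lambda>f. Poly_Mapping.map_key word_adjoint (Poly_Mapping.map cnj f))\<rparr>"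

definition free_gen :: "'g \<Rightarrow> 'g word \<Rightarrow>\<^sub>0 complex" where
  "free_gen g = Poly_Mapping.single (Word [Gen g]) 1"


section \<open>The relations of a partition\<close>

definition multi_indices :: "nat \<Rightarrow> nat \<Rightarrow> nat list set" where
  "multi_indices n k = {i. length i = k \<and> set i \<subseteq> {1..n}}"

fun label :: "nat list \<Rightarrow> nat list \<Rightarrow> point \<Rightarrow> nat" where
  "label i j (Up a) = i ! a"
| "label i j (Lo b) = j ! b"

definition delta :: "point set set \<Rightarrow> nat list \<Rightarrow> nat list \<Rightarrow> complex" where
  "delta p i j = (if \<forall>B\<in>p. \<forall>x\<in>B. \<forall>y\<in>B. label i j x = label i j y then 1 else 0)"

text \<open>The product \<open>u\<^bsub>i\<^sub>1j\<^sub>1\<^esub> \<cdots> u\<^bsub>i\<^sub>kj\<^sub>k\<^esub>\<close>, which is \<open>1\<close> for \<open>k = 0\<close>.\<close>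

definition monomial ::
    "('a, 'b) star_algebra_scheme \<Rightarrow> (nat \<Rightarrow> nat \<Rightarrow> 'a) \<Rightarrow> nat list \<Rightarrow> nat list \<Rightarrow> 'a" where
  "monomial A u i j = foldr (mult A) (map2 u i j) \<one>\<^bsub>A\<^esub>"

definition rel_lhs :: "('a, 'b) star_algebra_scheme \<Rightarrow> nat \<Rightarrow> (nat \<Rightarrow> nat \<Rightarrow> 'a) \<Rightarrow>
    nat \<Rightarrow> point set set \<Rightarrow> nat list \<Rightarrow> nat list \<Rightarrow> 'a" where
  "rel_lhs A n u k p \<alpha> \<beta> =
     (\<Oplus>\<^bsub>A\<^esub>\<gamma> \<in> multi_indices n k. delta p \<gamma> \<beta> \<odot>\<^bsub>A\<^esub> monomial A u \<gamma> \<alpha>)"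

definition rel_rhs :: "('a, 'b) star_algebra_scheme \<Rightarrow> nat \<Rightarrow> (nat \<Rightarrow> nat \<Rightarrow> 'a) \<Rightarrow>
    nat \<Rightarrow> point set set \<Rightarrow> nat list \<Rightarrow> nat list \<Rightarrow> 'a" where
  "rel_rhs A n u l p \<alpha> \<beta> =
     (\<Oplus>\<^bsub>A\<^esub>\<gamma> \<in> multi_indices n l. delta p \<alpha> \<gamma> \<odot>\<^bsub>A\<^esub> monomial A u \<beta> \<gamma>)"

text \<open>The relations \<open>R(p)\<close> for \<open>p \<in> Part k l\<close>.\<close>

definition fulfills_R :: "('a, 'b) star_algebra_scheme \<Rightarrow> nat \<Rightarrow> (nat \<Rightarrow> nat \<Rightarrow> 'a) \<Rightarrow>
    nat \<Rightarrow> nat \<Rightarrow> point set set \<Rightarrow> bool" where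
  "fulfills_R A n u k l p \<longleftrightarrow>
     (\<forall>i\<in>{1..n}. \<forall>j\<in>{1..n}. star A (u i j) = u i j) \<and>
     (\<forall>\<alpha>\<in>multi_indices n k. \<forall>\<beta>\<in>multi_indices n l. rel_lhs A n u k p \<alpha> \<beta> = rel_rhs A n u l p \<alpha> \<beta>)"


section \<open>Partition C*-algebras\<close>

abbreviation free_alg :: "nat \<Rightarrow> ((nat \<times> nat) word \<Rightarrow>\<^sub>0 complex) star_algebra" where
  "free_alg n \<equiv> free_star_algebra ({1..n} \<times> {1..n})"

abbreviation free_u :: "nat \<Rightarrow> nat \<Rightarrow> (nat \<times> nat) word \<Rightarrow>\<^sub>0 complex" where
  "free_u i j \<equiv> free_gen (i, j)"

definition relators :: "nat \<Rightarrow> point set set set \<Rightarrow> ((nat \<times> nat) word \<Rightarrow>\<^sub>0 complex) set" where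
  "relators n X =
     {free_u i j - star (free_alg n) (free_u i j) | i j. i \<in> {1..n} \<and> j \<in> {1..n}} \<union>
     {rel_lhs (free_alg n) n free_u k p \<alpha> \<beta> - rel_rhs (free_alg n) n free_u l p \<alpha> \<beta> | k l p \<alpha> \<beta>.
        p \<in> X \<and> p \<in> Part k l \<and> \<alpha> \<in> multi_indices n k \<and> \<beta> \<in> multi_indices n l}"

definition relator_ideal ::
    "nat \<Rightarrow> point set set set \<Rightarrow> ((nat \<times> nat) word \<Rightarrow>\<^sub>0 complex) set" where
  "relator_ideal n X = star_ideal_generated (free_alg n) (relators n X)"

definition universal_star_algebra ::
    "nat \<Rightarrow> point set set set \<Rightarrow> ((nat \<times> nat) word \<Rightarrow>\<^sub>0 complex) set star_algebra" where
  "universal_star_algebra n X = quotient_star_algebra (free_alg n) (relator_ideal n X)"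

definition admissible :: "nat \<Rightarrow> point set set set \<Rightarrow> bool" where
  "admissible n X \<longleftrightarrow> X \<subseteq> Partitions \<and> cstar_seminorms_bounded (universal_star_algebra n X)"

text \<open>The universal C*-algebra \<open>A\<^sub>n(X)\<close> and its generators; meaningful for admissible \<open>X\<close>.\<close>

definition partition_algebra ::
    "nat \<Rightarrow> point set set set \<Rightarrow>
      (nat \<Rightarrow> ((nat \<times> nat) word \<Rightarrow>\<^sub>0 complex) set) set normed_star_algebra" where
  "partition_algebra n X =
     completion (universal_star_algebra n X) (max_cstar_seminorm (universal_star_algebra n X))"

definition partition_gen ::
    "nat \<Rightarrow> point set set set \<Rightarrow> nat \<Rightarrow> nat \<Rightarrow>
      (nat \<Rightarrow> ((nat \<times> nat) word \<Rightarrow>\<^sub>0 complex) set) set" where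
  "partition_gen n X i j =
     completion_embed (universal_star_algebra n X) (max_cstar_seminorm (universal_star_algebra n X))
       (relator_ideal n X +>\<^bsub>free_alg n\<^esub> free_u i j)"

definition H_set :: "nat \<Rightarrow> point set set set \<Rightarrow> point set set set" where
  "H_set n X = {p. \<exists>k l. p \<in> Part k l \<and>
     fulfills_R (partition_algebra n X) n (partition_gen n X) k l p}"

end

theory Submission
  imports Defs
begin

text \<open>
  Let \<open>u\<close> be the matrix of the generators and \<open>U\<^sub>k\<close> the matrix of all monomials of degree \<open>k\<close>,
  indexed by multi-indices, that is, the \<open>k\<close>-th tensor power of \<open>u\<close>. Let \<open>T\<^sub>p\<close> be the scalar
  matrix with entries \<open>\<delta>\<^sub>p\<close>. For \<open>p\<close> with \<open>k\<close> upper and \<open>l\<close> lower points, the relations \<open>R(p)\<close>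
  say that \<open>u\<close> consists of self-adjoint elements and that \<open>T\<^sub>p\<close> intertwines tensor powers,
  \<open>T\<^sub>p U\<^sub>k = U\<^sub>l T\<^sub>p\<close> (\<open>fulfills_R_iff_intertwines\<close>). The partition operations become operations
  on matrices that preserve this equation.

  \<^item> The identity partition yields the identity matrix.
  \<^item> The tensor product of partitions yields the tensor product of matrices.
  \<^item> The composition yields the matrix product up to a nonzero factor
    (\<open>sum_delta_compose\<close>), which can be cancelled. The factor counts the labellings of the
    middle components that are discarded.
  \<^item> Reflection amounts to applying the star to the relations, which reverses all products
    of the self-adjoint generators (\<open>intertwines_reverse\<close>).
  \<^item> The relations of the two pair partitions say that \<open>u\<close> is orthogonal, whence all \<open>U\<^sub>k\<close>
    are unitary. Then \<open>T U\<^sub>k = U\<^sub>l T\<close> is equivalent to \<open>U\<^sub>l\<^sup>* T = T U\<^sub>k\<^sup>*\<close>, and the adjoint of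
    the latter is the relation for the upside-down partition (\<open>intertwines_adjoint\<close>).

  These arguments work in every unital star-algebra with self-adjoint elements \<open>u\<^sub>i\<^sub>j\<close>. The rest
  of the proof shows that the partition algebra is one: the free star-algebra is, and the
  property passes to the quotient by a star-ideal, to the algebra of Cauchy sequences for a
  C*-seminorm, and so to the completion, since the null sequences form a star-ideal there
  (\<open>partition_algebra_generators\<close>).
\<close>

section \<open>Partitions\<close>

lemma Up_in_points [simp]: "Up a \<in> points k l \<longleftrightarrow> a < k"
  and Lo_in_points [simp]: "Lo b \<in> points k l \<longleftrightarrow> b < l"
  by (auto simp: points_def)

lemma points_eq_iff: "points k l = points k' l' \<longleftrightarrow> k = k' \<and> l = l'"
proof
  assume *: "points k l = points k' l'"
  have "a < k \<longleftrightarrow> a < k'" "a < l \<longleftrightarrow> a < l'" for a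
    using Up_in_points[of a k l] Up_in_points[of a k' l'] Lo_in_points[of a k l] Lo_in_points[of a k' l']
    unfolding * by blast+
  then show "k = k' \<and> l = l'" by (metis nat_neq_iff)
qed auto

text \<open>Membership in \<^const>\<open>H_set\<close> quantifies existentially over the row lengths; since they
  are determined by the partition, this amounts to one set of relations.\<close>

lemma Part_unique: "p \<in> Part k l \<Longrightarrow> p \<in> Part k' l' \<Longrightarrow> k' = k \<and> l' = l"
  by (metis Part_def mem_Collect_eq partition_onD1 points_eq_iff)

lemma block_subset_points: "p \<in> Part k l \<Longrightarrow> B \<in> p \<Longrightarrow> x \<in> B \<Longrightarrow> x \<in> points k l"
  using partition_onD1 by (fastforce simp: Part_def)

lemma id_part_in_Part: "id_part \<in> Part 1 1"
  by (auto simp: Part_def id_part_def points_def intro!: partition_onI)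

lemma cap_part_in_Part: "cap_part \<in> Part 0 2"
  by (auto simp: Part_def cap_part_def points_def lessThan_Suc numeral_2_eq_2 intro!: partition_onI)

lemma cup_part_in_Part: "cup_part \<in> Part 2 0"
  by (auto simp: Part_def cup_part_def points_def lessThan_Suc numeral_2_eq_2 intro!: partition_onI)

lemma partition_on_image:
  assumes "partition_on A P" and "inj_on f A"
  shows "partition_on (f ` A) ((`) f ` P)"
proof -
  have "(`) f ` P - {{}} = (`) f ` P"
    using partition_onD3[OF assms(1)] by auto
  then show ?thesis
    using partition_on_inj_image[OF assms] by simp
qed

lemma inj_shift: "inj (shift k l)"
proof (rule injI)
  fix x y assume "shift k l x = shift k l y"
  then show "x = y" by (cases x; cases y) simp_all
qed

lemma shift_points: "shift k l ` points k' l' = points (k + k') (l + l') - points k l"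
proof (rule Set.set_eqI)
  fix x
  show "x \<in> shift k l ` points k' l' \<longleftrightarrow> x \<in> points (k + k') (l + l') - points k l"
  proof (cases x)
    case (Up a)
    have "\<exists>y\<in>points k' l'. Up a = shift k l y" if "a < k + k'" "k \<le> a"
      using that by (intro bexI[of _ "Up (a - k)"]) auto
    then show ?thesis
      using Up by (auto simp: points_def image_iff)
  next
    case (Lo a)
    have "\<exists>y\<in>points k' l'. Lo a = shift k l y" if "a < l + l'" "l \<le> a"
      using that by (intro bexI[of _ "Lo (a - l)"]) auto
    then show ?thesis
      using Lo by (auto simp: points_def image_iff)
  qed
qed

lemma tensor_part_in_Part:
  assumes "p \<in> Part k l" "q \<in> Part k' l'"
  shows "tensor_part k l p q \<in> Part (k + k') (l + l')"
proof -
  have p: "partition_on (points k l) p"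
    and q: "partition_on (points (k + k') (l + l') - points k l) ((`) (shift k l) ` q)"
    using assms partition_on_image[of "points k' l'" q "shift k l"]
    by (auto simp: Part_def shift_points inj_on_subset[OF inj_shift])
  have *: "points k l \<union> (points (k + k') (l + l') - points k l) = points (k + k') (l + l')"
    by (auto simp: points_def)
  have "partition_on (points (k + k') (l + l')) (p \<union> (`) (shift k l) ` q)"
  proof (rule partition_onI)
    show "\<Union> (p \<union> (`) (shift k l) ` q) = points (k + k') (l + l')"
      using partition_onD1[OF p] partition_onD1[OF q] * by auto
    show "{} \<notin> p \<union> (`) (shift k l) ` q"
      using partition_onD3[OF p] partition_onD3[OF q] by blast
    have cross: "disjnt B C" if "B \<in> p" "C \<in> (`) (shift k l) ` q" for B C
      using that partition_onD1[OF p] partition_onD1[OF q] by (auto simp: disjnt_iff)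
    show "disjnt B C" if "B \<in> p \<union> (`) (shift k l) ` q" "C \<in> p \<union> (`) (shift k l) ` q" "B \<noteq> C" for B C
      using that partition_onD2[OF p] partition_onD2[OF q] cross
      unfolding pairwise_def by (metis Un_iff disjnt_sym)
  qed
  then show ?thesis by (simp add: Part_def tensor_part_def)
qed

lemma reverse_points: "reverse k l ` points k l = points k l"
proof -
  have "x \<in> points k l \<Longrightarrow> reverse k l x \<in> points k l \<and> reverse k l (reverse k l x) = x" for x
    by (cases x) auto
  then show ?thesis by force
qed

lemma reflection_in_Part: "p \<in> Part k l \<Longrightarrow> reflection k l p \<in> Part k l"
proof -
  have "inj_on (reverse k l) (points k l)"
    by (intro inj_onI) (auto simp: points_def)
  then show "p \<in> Part k l \<Longrightarrow> reflection k l p \<in> Part k l"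
    using partition_on_image[of "points k l" p "reverse k l"]
    by (simp add: Part_def reflection_def reverse_points)
qed

lemma involution_in_Part: "p \<in> Part k l \<Longrightarrow> involution p \<in> Part l k"
proof -
  have "inj_on flip (points k l)" "flip ` points k l = points l k"
    by (auto intro!: inj_onI simp: points_def image_Un image_image)
  then show "p \<in> Part k l \<Longrightarrow> involution p \<in> Part l k"
    using partition_on_image[of "points k l" p flip] by (simp add: Part_def involution_def)
qed

section \<open>The numbers \<open>\<delta>\<^sub>p\<close> under the partition operations\<close>

lemma cnj_delta [simp]: "cnj (delta p i j) = delta p i j"
  by (simp add: delta_def)

lemma if_1_0_neq_0_iff: "(if P then 1 else (0::complex)) \<noteq> 0 \<longleftrightarrow> P"
  by simp

lemma if_conj_mult:
  "(if A \<and> B then 1 else 0) = (if A then 1 else 0) * (if B then 1 else (0::complex))"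
  by simp

lemma delta_id_part: "delta id_part [a] [b] = (if b = a then 1 else 0)"
  by (auto simp: delta_def id_part_def)

lemma delta_cap_part: "delta cap_part [] [a, b] = (if a = b then 1 else 0)"
  by (auto simp: delta_def cap_part_def)

lemma delta_cup_part: "delta cup_part [a, b] [] = (if a = b then 1 else 0)"
  by (auto simp: delta_def cup_part_def)

lemma label_append_points:
  assumes "length i = k" "length j = l" "x \<in> points k l"
  shows "label (i @ i') (j @ j') x = label i j x"
  using assms by (cases x) (simp_all add: nth_append)

lemma label_append_shift:
  assumes "length i = k" "length j = l"
  shows "label (i @ i') (j @ j') (shift k l x) = label i' j' x"
  using assms by (cases x) (simp_all add: nth_append)

lemma label_reverse:
  assumes "length i = k" "length j = l" "x \<in> points k l"
  shows "label i j (reverse k l x) = label (rev i) (rev j) x"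
  using assms by (cases x) (simp_all add: rev_nth)

lemma delta_tensor_part:
  assumes "p \<in> Part k l" "length i = k" "length j = l"
  shows "delta (tensor_part k l p q) (i @ i') (j @ j') = delta p i j * delta q i' j'"
proof -
  have p: "label (i @ i') (j @ j') x = label i j x" if "B \<in> p" "x \<in> B" for B x
    by (rule label_append_points[OF assms(2,3) block_subset_points[OF assms(1) that]])
  have q: "label (i @ i') (j @ j') (shift k l x) = label i' j' x" for x
    by (rule label_append_shift[OF assms(2,3)])
  have "(\<forall>B\<in>p. \<forall>x\<in>B. \<forall>y\<in>B. label (i @ i') (j @ j') x = label (i @ i') (j @ j') y) \<longleftrightarrow>
      (\<forall>B\<in>p. \<forall>x\<in>B. \<forall>y\<in>B. label i j x = label i j y)"
    (is "(\<forall>B\<in>p. \<forall>x\<in>B. \<forall>y\<in>B. ?l B x y) \<longleftrightarrow> (\<forall>B\<in>p. \<forall>x\<in>B. \<forall>y\<in>B. ?r B x y)")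
  proof (intro ball_cong refl)
    fix B x y assume "B \<in> p" "x \<in> B" "y \<in> B"
    then show "?l B x y \<longleftrightarrow> ?r B x y" by (simp only: p)
  qed
  then show ?thesis
    unfolding delta_def tensor_part_def by (simp only: ball_Un ball_simps q if_conj_mult)
qed

lemma delta_reflection:
  assumes "p \<in> Part k l" "length i = k" "length j = l"
  shows "delta (reflection k l p) i j = delta p (rev i) (rev j)"
proof -
  have p: "label i j (reverse k l x) = label (rev i) (rev j) x" if "B \<in> p" "x \<in> B" for B x
    by (rule label_reverse[OF assms(2,3) block_subset_points[OF assms(1) that]])
  have "(\<forall>B\<in>p. \<forall>x\<in>B. \<forall>y\<in>B. label i j (reverse k l x) = label i j (reverse k l y)) \<longleftrightarrow>
      (\<forall>B\<in>p. \<forall>x\<in>B. \<forall>y\<in>B. label (rev i) (rev j) x = label (rev i) (rev j) y)"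
    (is "(\<forall>B\<in>p. \<forall>x\<in>B. \<forall>y\<in>B. ?l B x y) \<longleftrightarrow> (\<forall>B\<in>p. \<forall>x\<in>B. \<forall>y\<in>B. ?r B x y)")
  proof (intro ball_cong refl)
    fix B x y assume "B \<in> p" "x \<in> B" "y \<in> B"
    then show "?l B x y \<longleftrightarrow> ?r B x y" by (simp only: p)
  qed
  then show ?thesis
    unfolding delta_def reflection_def by (simp only: ball_simps)
qed

lemma delta_involution: "delta (involution p) i j = delta p j i"
proof -
  have "label i j (flip x) = label j i x" for x by (cases x) auto
  then show ?thesis unfolding delta_def involution_def by (simp only: ball_simps)
qed

lemma multi_indices_0: "multi_indices n 0 = {[]}"
  by (auto simp: multi_indices_def)

lemma finite_multi_indices [simp]: "finite (multi_indices n k)"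
  using finite_lists_length_eq[of "{1..n}" k] by (simp add: multi_indices_def conj_commute)

lemma multi_indices_Suc: "multi_indices n (Suc k) = (\<lambda>(a, i). a # i) ` ({1..n} \<times> multi_indices n k)"
  by (auto simp: multi_indices_def length_Suc_conv image_iff)

lemma multi_indices_add:
  "multi_indices n (k + k') = (\<lambda>(i, j). i @ j) ` (multi_indices n k \<times> multi_indices n k')"
proof (intro Set.set_eqI iffI)
  fix i assume i: "i \<in> multi_indices n (k + k')"
  then have "take k i \<in> multi_indices n k" "drop k i \<in> multi_indices n k'"
    by (auto simp: multi_indices_def dest: in_set_takeD in_set_dropD)
  then show "i \<in> (\<lambda>(i, j). i @ j) ` (multi_indices n k \<times> multi_indices n k')"
    by (intro image_eqI[of _ _ "(take k i, drop k i)"]) simp_all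
next
  fix i assume "i \<in> (\<lambda>(i, j). i @ j) ` (multi_indices n k \<times> multi_indices n k')"
  then show "i \<in> multi_indices n (k + k')" by (fastforce simp: multi_indices_def)
qed

lemma rev_multi_indices: "rev ` multi_indices n k = multi_indices n k"
proof -
  have "rev i \<in> multi_indices n k \<longleftrightarrow> i \<in> multi_indices n k" for i
    by (simp add: multi_indices_def)
  then show ?thesis by force
qed

lemma rev_in_multi_indices: "rev i \<in> multi_indices n k \<longleftrightarrow> i \<in> multi_indices n k"
  by (simp add: multi_indices_def)

section \<open>Composition and the matrices \<open>T\<^sub>p\<close>\<close>

fun label3 :: "nat list \<Rightarrow> nat list \<Rightarrow> nat list \<Rightarrow> point3 \<Rightarrow> nat" where
  "label3 i h j (Top a) = i ! a"
| "label3 i h j (Mid b) = h ! b"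
| "label3 i h j (Bot c) = j ! c"

text \<open>The relation of lying in a common block of the stacked diagram; connectedness in the
  composition is its reflexive-transitive closure.\<close>

definition adjacent3 :: "point set set \<Rightarrow> point set set \<Rightarrow> (point3 \<times> point3) set" where
  "adjacent3 q p = {(x, y). \<exists>B \<in> (`) place_above ` p \<union> (`) place_below ` q. x \<in> B \<and> y \<in> B}"

lemma connected3_eq: "connected3 q p = (adjacent3 q p)\<^sup>*"
  by (simp add: connected3_def adjacent3_def)

lemma sym_connected3: "sym (connected3 q p)"
  unfolding connected3_eq by (rule sym_rtrancl) (auto simp: sym_def adjacent3_def)

lemma trans_connected3: "trans (connected3 q p)"
  unfolding connected3_eq by (rule trans_rtrancl)

lemma equiv_outer_connected3:
  "equiv (points k m)
     {(x, y) \<in> points k m \<times> points k m. (outer x, outer y) \<in> connected3 q p}"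
proof (rule equivI)
  let ?r = "{(x, y) \<in> points k m \<times> points k m. (outer x, outer y) \<in> connected3 q p}"
  show "?r \<subseteq> points k m \<times> points k m" by blast
  show "refl_on (points k m) ?r" by (auto intro!: refl_onI simp: connected3_eq)
  show "sym ?r" using symD[OF sym_connected3[of q p]] by (auto intro!: symI)
  show "trans ?r" using transD[OF trans_connected3[of q p]] by (blast intro!: transI)
qed

lemma compose_part_in_Part: "compose_part k m q p \<in> Part k m"
  unfolding Part_def compose_part_def using partition_on_quotient[OF equiv_outer_connected3] by simp

text \<open>The blocks of the composition are the classes of connected outer points, so a labelling
  of the outer rows is compatible with it iff it is constant along connections.\<close>

lemma delta_compose_part:
  "delta (compose_part k m q p) i j = (if \<forall>x\<in>points k m. \<forall>y\<in>points k m.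
     (outer x, outer y) \<in> connected3 q p \<longrightarrow> label i j x = label i j y then 1 else 0)"
proof -
  let ?r = "{(x, y) \<in> points k m \<times> points k m. (outer x, outer y) \<in> connected3 q p}"
  have "(\<forall>B\<in>points k m // ?r. \<forall>x\<in>B. \<forall>y\<in>B. label i j x = label i j y) \<longleftrightarrow>
        (\<forall>x\<in>points k m. \<forall>y\<in>points k m.
           (outer x, outer y) \<in> connected3 q p \<longrightarrow> label i j x = label i j y)" (is "?L \<longleftrightarrow> ?R")
  proof
    assume L: ?L
    have "label i j x = label i j y" if "(x, y) \<in> ?r" for x y
    proof -
      have "x \<in> points k m" using that by simp
      then have "?r `` {x} \<in> points k m // ?r" and "x \<in> ?r `` {x}"
        by (rule quotientI, rule equiv_class_self[OF equiv_outer_connected3])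
      moreover have "y \<in> ?r `` {x}" using that by (rule ImageI) simp
      ultimately show ?thesis by (rule L[rule_format])
    qed
    then show ?R by simp
  next
    assume R: ?R
    show ?L
    proof (intro ballI)
      fix B x y assume "B \<in> points k m // ?r" "x \<in> B" "y \<in> B"
      then have "(x, y) \<in> ?r"
        by (intro in_quotient_imp_in_rel[OF equiv_outer_connected3]) simp_all
      then have "x \<in> points k m" "y \<in> points k m" "(outer x, outer y) \<in> connected3 q p"
        by simp_all
      then show "label i j x = label i j y" by (rule R[rule_format])
    qed
  qed
  then show ?thesis
    unfolding delta_def compose_part_def by (simp only:)
qed

lemma delta_mult_delta:
  "delta p i h * delta q h j =
     (if \<forall>(x, y)\<in>adjacent3 q p. label3 i h j x = label3 i h j y then 1 else 0)"
proof -
  have p: "label3 i h j (place_above x) = label i h x" for x by (cases x) auto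
  have q: "label3 i h j (place_below x) = label h j x" for x by (cases x) auto
  have "(\<forall>(x, y)\<in>adjacent3 q p. label3 i h j x = label3 i h j y) \<longleftrightarrow>
     (\<forall>B\<in>(`) place_above ` p \<union> (`) place_below ` q. \<forall>x\<in>B. \<forall>y\<in>B. label3 i h j x = label3 i h j y)"
    unfolding adjacent3_def by blast
  also have "\<dots> \<longleftrightarrow> (\<forall>B\<in>p. \<forall>x\<in>B. \<forall>y\<in>B. label i h x = label i h y) \<and>
       (\<forall>B\<in>q. \<forall>x\<in>B. \<forall>y\<in>B. label h j x = label h j y)"
    by (simp only: ball_Un ball_simps p q)
  finally show ?thesis by (simp only: delta_def if_conj_mult)
qed

text \<open>The labellings \<open>h\<close> of the middle row that are compatible with \<open>p\<close> above (outer row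
  labelled by \<open>i\<close>) and with \<open>q\<close> below (outer row labelled by \<open>j\<close>). Their number is the
  entry at \<open>(j, i)\<close> of the matrix product of the zero-one matrices belonging to \<open>q\<close> and \<open>p\<close>.\<close>

definition middle_labellings ::
    "nat \<Rightarrow> nat \<Rightarrow> point set set \<Rightarrow> point set set \<Rightarrow> nat list \<Rightarrow> nat list \<Rightarrow> nat list set" where
  "middle_labellings n l q p i j =
     {h \<in> multi_indices n l. \<forall>(x, y)\<in>adjacent3 q p. label3 i h j x = label3 i h j y}"

lemma middle_labellingsI:
  assumes "h \<in> multi_indices n l"
    and "\<And>x y. (x, y) \<in> adjacent3 q p \<Longrightarrow> label3 i h j x = label3 i h j y"
  shows "h \<in> middle_labellings n l q p i j"
  using assms unfolding middle_labellings_def by blast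

lemma middle_labellingsD:
  assumes "h \<in> middle_labellings n l q p i j"
  shows "h \<in> multi_indices n l"
    and "(x, y) \<in> adjacent3 q p \<Longrightarrow> label3 i h j x = label3 i h j y"
  using assms unfolding middle_labellings_def by blast+

lemma finite_middle_labellings [simp]: "finite (middle_labellings n l q p i j)"
  by (simp add: middle_labellings_def)

lemma sum_delta_mult_delta:
  "(\<Sum>h\<in>multi_indices n l. delta p i h * delta q h j) = of_nat (card (middle_labellings n l q p i j))"
  unfolding delta_mult_delta middle_labellings_def
  by (simp add: sum.If_cases Int_def conj_commute)

lemma label3_connected3:
  assumes "h \<in> middle_labellings n l q p i j" "(x, y) \<in> connected3 q p"
  shows "label3 i h j x = label3 i h j y"
  using assms(2) unfolding connected3_eq
proof (induction rule: rtrancl_induct)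
  case (step y z)
  then show ?case using middle_labellingsD(2)[OF assms(1) step.hyps(2)] by (simp only:)
qed (rule refl)

lemma label3_outer: "label3 i h j (outer x) = label i j x"
  by (cases x) auto

lemma middle_labellings_empty:
  assumes "delta (compose_part k m q p) i j = 0"
  shows "middle_labellings n l q p i j = {}"
proof -
  obtain x y where "(outer x, outer y) \<in> connected3 q p" "label i j x \<noteq> label i j y"
    using assms by (auto simp: delta_compose_part split: if_splits)
  then have "h \<notin> middle_labellings n l q p i j" for h
    using label3_connected3[of h n l q p i j "outer x" "outer y"] by (simp only: label3_outer) blast
  then show ?thesis by blast
qed

text \<open>A middle point connected to an outer point has its label forced, and the labels of
  all other middle points are constrained only among themselves. Hence replacing the outer
  labels \<open>i, j\<close> by other compatible ones \<open>i', j'\<close> and adapting the forced middle labels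
  maps middle labellings injectively to middle labellings. By symmetry, the number of middle
  labellings is the same for all compatible outer labels.\<close>

lemma card_middle_labellings_le:
  assumes p: "p \<in> Part k l" and q: "q \<in> Part l m"
    and i: "i' \<in> multi_indices n k" and j: "j' \<in> multi_indices n m"
    and compatible: "delta (compose_part k m q p) i' j' \<noteq> 0"
  shows "card (middle_labellings n l q p i j) \<le> card (middle_labellings n l q p i' j')"
proof -
  let ?E = "connected3 q p"
  \<comment> \<open>A vertex is attached if it is connected to an outer point; its anchor is one such point.\<close>
  define attached where "attached v \<longleftrightarrow> (\<exists>z\<in>points k m. (v, outer z) \<in> ?E)" for v
  define anchor where "anchor v = (SOME z. z \<in> points k m \<and> (v, outer z) \<in> ?E)" for v
  define relabel where
    "relabel h = map (\<lambda>b. if attached (Mid b) then label i' j' (anchor (Mid b)) else h ! b) [0..<l]"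
    for h :: "nat list"
  have anchor: "anchor v \<in> points k m" "(v, outer (anchor v)) \<in> ?E" if "attached v" for v
    using that someI_ex[of "\<lambda>z. z \<in> points k m \<and> (v, outer z) \<in> ?E"]
    unfolding attached_def anchor_def by blast+
  \<comment> \<open>Compatibility of the new outer labels makes the forced label independent of the anchor.\<close>
  have same: "label i' j' z = label i' j' z'"
    if "z \<in> points k m" "z' \<in> points k m" "(v, outer z) \<in> ?E" "(v, outer z') \<in> ?E" for z z' v
  proof -
    have "(outer z, outer z') \<in> ?E"
      using that sym_connected3[of q p] trans_connected3[of q p] by (meson symD transD)
    then show ?thesis
      using that compatible[unfolded delta_compose_part if_1_0_neq_0_iff] by blast
  qed
  have attached_cong: "attached v \<longleftrightarrow> attached w" if "(v, w) \<in> ?E" for v w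
    using that sym_connected3[of q p] trans_connected3[of q p]
    unfolding attached_def by (meson symD transD)
  have range: "label i' j' z \<in> {1..n}" if "z \<in> points k m" for z
    using i j that by (cases z) (auto simp: multi_indices_def subset_iff dest!: spec nth_mem)
  have vertex: "(\<exists>b<l. v = Mid b) \<or> (\<exists>z\<in>points k m. v = outer z)" if "(v, w) \<in> adjacent3 q p" for v w
  proof -
    from that consider B x where "B \<in> p" "x \<in> B" "v = place_above x"
      | B x where "B \<in> q" "x \<in> B" "v = place_below x"
      unfolding adjacent3_def by blast
    then show ?thesis
    proof cases
      case 1
      then have "x \<in> points k l" using p block_subset_points by blast
      then show ?thesis using 1 by (cases x) (auto intro: bexI[of _ "Up _"])
    next
      case 2
      then have "x \<in> points l m" using q block_subset_points by blast
      then show ?thesis using 2 by (cases x) (auto intro: bexI[of _ "Lo _"])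
    qed
  qed
  have adj: "(v, w) \<in> ?E \<and> (w, v) \<in> adjacent3 q p" if "(v, w) \<in> adjacent3 q p" for v w
  proof
    show "(v, w) \<in> ?E" using that unfolding connected3_eq by (rule r_into_rtrancl)
    show "(w, v) \<in> adjacent3 q p" using that unfolding adjacent3_def by blast
  qed
  have relabel_attached: "label3 i' (relabel h) j' v = label i' j' z"
    if v: "(\<exists>b<l. v = Mid b) \<or> (\<exists>z\<in>points k m. v = outer z)"
      and z: "z \<in> points k m" "(v, outer z) \<in> ?E" for h v z
    using v
  proof
    assume "\<exists>b<l. v = Mid b"
    then obtain b where "b < l" "v = Mid b" by blast
    moreover have "attached v" using z attached_def by blast
    ultimately show ?thesis
      using same[OF anchor(1) z(1) anchor(2) z(2)] by (simp add: relabel_def)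
  next
    assume "\<exists>z\<in>points k m. v = outer z"
    then obtain z' where "z' \<in> points k m" "v = outer z'" by blast
    then show ?thesis
      using same[of z' z v] z by (simp add: label3_outer connected3_eq)
  qed
  have relabel_free: "label3 i' (relabel h) j' v = label3 i h j v"
    if v: "(\<exists>b<l. v = Mid b) \<or> (\<exists>z\<in>points k m. v = outer z)" and "\<not> attached v" for h v
  proof -
    have "\<not> (\<exists>z\<in>points k m. v = outer z)"
      using \<open>\<not> attached v\<close> unfolding attached_def connected3_eq by blast
    then show ?thesis using v \<open>\<not> attached v\<close> by (auto simp: relabel_def)
  qed
  have maps: "relabel h \<in> middle_labellings n l q p i' j'" if h: "h \<in> middle_labellings n l q p i j" for h
  proof -
    have "relabel h \<in> multi_indices n l"
    proof -
      have "h ! b \<in> {1..n}" if "b < l" for b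
        using middle_labellingsD(1)[OF h] that nth_mem[of b h] unfolding multi_indices_def by blast
      then show ?thesis
        using range anchor(1) by (fastforce simp: multi_indices_def relabel_def)
    qed
    moreover have "label3 i' (relabel h) j' v = label3 i' (relabel h) j' w"
      if vw: "(v, w) \<in> adjacent3 q p" for v w
    proof (cases "attached v")
      case True
      have "(w, outer (anchor v)) \<in> ?E"
        using anchor(2)[OF True] adj[OF vw] sym_connected3[of q p] trans_connected3[of q p]
        by (meson symD transD)
      then show ?thesis
        using relabel_attached[OF vertex[OF vw] anchor[OF True]]
          relabel_attached[OF vertex[OF conjunct2[OF adj[OF vw]]] anchor(1)[OF True]] by simp
    next
      case False
      then have "\<not> attached w" using attached_cong adj[OF vw] by blast
      then show ?thesis
        using relabel_free[OF vertex[OF vw] False] middle_labellingsD(2)[OF h vw]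
          relabel_free[OF vertex[OF conjunct2[OF adj[OF vw]]]]
        by simp
    qed
    ultimately show ?thesis by (rule middle_labellingsI)
  qed
  have inj: "inj_on relabel (middle_labellings n l q p i j)"
  proof (rule inj_onI)
    fix h h' assume h: "h \<in> middle_labellings n l q p i j" and h': "h' \<in> middle_labellings n l q p i j"
      and eq: "relabel h = relabel h'"
    have len: "length h = l" "length h' = l"
      using middle_labellingsD(1)[OF h] middle_labellingsD(1)[OF h'] by (auto simp: multi_indices_def)
    moreover have "h ! b = h' ! b" if b: "b < l" for b
    proof (cases "attached (Mid b)")
      case True
      then show ?thesis
        using label3_connected3[OF h anchor(2)[OF True]] label3_connected3[OF h' anchor(2)[OF True]]
        by (simp add: label3_outer)
    next
      case False
      then show ?thesis
        using relabel_free[of "Mid b" h] relabel_free[of "Mid b" h'] b eq by simp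
    qed
    ultimately show "h = h'" by (simp add: nth_equalityI)
  qed
  show ?thesis
    by (rule card_inj_on_le[OF inj]) (use maps in auto)
qed

text \<open>In matrix form, \<open>T\<^sub>q T\<^sub>p = c T\<^sub>q\<^sub>p\<close>. The factor \<open>c\<close> is \<open>n\<close> to the number of components that
  consist of middle points only; what matters is that it is nonzero and does not depend on
  the outer labels. As it is found by counting for the labels that are constantly \<open>1\<close>,
  the hypothesis \<open>n \<ge> 1\<close> enters here.\<close>

lemma sum_delta_compose:
  assumes n: "n \<ge> 1" and p: "p \<in> Part k l" and q: "q \<in> Part l m"
  obtains c :: complex where "c \<noteq> 0"
    "\<And>i j. i \<in> multi_indices n k \<Longrightarrow> j \<in> multi_indices n m \<Longrightarrow>
       (\<Sum>h\<in>multi_indices n l. delta p i h * delta q h j) = c * delta (compose_part k m q p) i j"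
proof
  let ?ones = "\<lambda>k. replicate k (1::nat)"
  let ?c = "card (middle_labellings n l q p (?ones k) (?ones m))"
  have ones: "?ones k \<in> multi_indices n k" for k
    using n by (auto simp: multi_indices_def)
  have label_ones: "label (?ones k) (?ones l) x = 1" if "x \<in> points k l" for x k l
    using that by (cases x) auto
  have "delta p (?ones k) (?ones l) * delta q (?ones l) (?ones m) \<noteq> 0"
  proof -
    have "\<forall>B\<in>p. \<forall>x\<in>B. \<forall>y\<in>B. label (?ones k) (?ones l) x = label (?ones k) (?ones l) y"
      using label_ones block_subset_points[OF p] by metis
    moreover have "\<forall>B\<in>q. \<forall>x\<in>B. \<forall>y\<in>B. label (?ones l) (?ones m) x = label (?ones l) (?ones m) y"
      using label_ones block_subset_points[OF q] by metis
    ultimately show ?thesis unfolding delta_def if_conj_mult[symmetric] if_1_0_neq_0_iff by (rule conjI)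
  qed
  then have "?ones l \<in> middle_labellings n l q p (?ones k) (?ones m)"
    unfolding delta_mult_delta if_1_0_neq_0_iff middle_labellings_def using ones by blast
  then show "of_nat ?c \<noteq> (0::complex)" by auto
  have "label (?ones k) (?ones m) x = label (?ones k) (?ones m) y"
    if "x \<in> points k m" "y \<in> points k m" for x y
    using that by (simp only: label_ones)
  then have comp: "delta (compose_part k m q p) (?ones k) (?ones m) \<noteq> 0"
    unfolding delta_compose_part if_1_0_neq_0_iff by blast
  fix i j assume ij: "i \<in> multi_indices n k" "j \<in> multi_indices n m"
  show "(\<Sum>h\<in>multi_indices n l. delta p i h * delta q h j) = of_nat ?c * delta (compose_part k m q p) i j"
  proof (cases "delta (compose_part k m q p) i j = 0")
    case True
    then show ?thesis by (simp add: sum_delta_mult_delta middle_labellings_empty[OF True])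
  next
    case False
    then have "card (middle_labellings n l q p i j) = ?c"
      using card_middle_labellings_le[OF p q] ij ones comp by (meson le_antisym)
    moreover have "delta (compose_part k m q p) i j = 1"
      using False unfolding delta_def if_1_0_neq_0_iff by (rule if_P)
    ultimately show ?thesis by (simp add: sum_delta_mult_delta)
  qed
qed

section \<open>Unital star-algebras on a carrier set\<close>

text \<open>The axioms are relative to the carrier, so that the free algebra, its quotients, the
  algebra of Cauchy sequences and the completion, which need not fill their types, are all
  instances.\<close>

locale unital_star_algebra = ring A for A :: "('a, 'b) star_algebra_scheme" (structure) +
  assumes smult_closed [simp, intro]: "x \<in> carrier A \<Longrightarrow> c \<odot> x \<in> carrier A"
    and smult_add_left: "x \<in> carrier A \<Longrightarrow> (c + d) \<odot> x = c \<odot> x \<oplus> d \<odot> x"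
    and smult_add_right: "\<lbrakk>x \<in> carrier A; y \<in> carrier A\<rbrakk> \<Longrightarrow> c \<odot> (x \<oplus> y) = c \<odot> x \<oplus> c \<odot> y"
    and smult_smult: "x \<in> carrier A \<Longrightarrow> c \<odot> (d \<odot> x) = (c * d) \<odot> x"
    and smult_1 [simp]: "x \<in> carrier A \<Longrightarrow> 1 \<odot> x = x"
    and mult_smult_left: "\<lbrakk>x \<in> carrier A; y \<in> carrier A\<rbrakk> \<Longrightarrow> (c \<odot> x) \<otimes> y = c \<odot> (x \<otimes> y)"
    and mult_smult_right: "\<lbrakk>x \<in> carrier A; y \<in> carrier A\<rbrakk> \<Longrightarrow> x \<otimes> (c \<odot> y) = c \<odot> (x \<otimes> y)"
    and star_closed [simp, intro]: "x \<in> carrier A \<Longrightarrow> star A x \<in> carrier A"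
    and star_star [simp]: "x \<in> carrier A \<Longrightarrow> star A (star A x) = x"
    and star_add: "\<lbrakk>x \<in> carrier A; y \<in> carrier A\<rbrakk> \<Longrightarrow> star A (x \<oplus> y) = star A x \<oplus> star A y"
    and star_mult: "\<lbrakk>x \<in> carrier A; y \<in> carrier A\<rbrakk> \<Longrightarrow> star A (x \<otimes> y) = star A y \<otimes> star A x"
    and star_smult: "x \<in> carrier A \<Longrightarrow> star A (c \<odot> x) = cnj c \<odot> star A x"
begin

lemma smult_zero_left [simp]: "x \<in> carrier A \<Longrightarrow> 0 \<odot> x = \<zero>"
  using smult_add_left[of x 0 0] add.l_cancel_one[of "0 \<odot> x" "0 \<odot> x"] by simp

lemma smult_zero_right [simp]: "c \<odot> \<zero> = \<zero>"
  using smult_add_right[of \<zero> \<zero> c] add.l_cancel_one[of "c \<odot> \<zero>" "c \<odot> \<zero>"] by simp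

lemma star_zero [simp]: "star A \<zero> = \<zero>"
  using star_add[of \<zero> \<zero>] add.l_cancel_one[of "star A \<zero>" "star A \<zero>"] by simp

lemma star_one [simp]: "star A \<one> = \<one>"
  using star_mult[of "star A \<one>" \<one>] by simp

lemma smult_minus_one: "x \<in> carrier A \<Longrightarrow> (-1) \<odot> x = \<ominus> x"
  using smult_add_left[of x "-1" 1] by (intro minus_equality[symmetric]) auto

lemma star_minus: "x \<in> carrier A \<Longrightarrow> star A (\<ominus> x) = \<ominus> star A x"
  using star_add[of x "\<ominus> x"] by (intro minus_equality[symmetric]) (auto simp: r_neg a_comm)

lemma finsum_smult:
  assumes "f \<in> I \<rightarrow> carrier A"
  shows "c \<odot> (\<Oplus>i\<in>I. f i) = (\<Oplus>i\<in>I. c \<odot> f i)"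
  using assms
  by (induction I rule: infinite_finite_induct) (simp_all add: Pi_def smult_add_right)

lemma smult_sum_left:
  assumes "x \<in> carrier A" 
  shows "(\<Sum>i\<in>I. c i) \<odot> x = (\<Oplus>i\<in>I. c i \<odot> x)"
  using assms
  by (induction I rule: infinite_finite_induct) (simp_all add: Pi_def smult_add_left)

lemma star_finsum:
  assumes "f \<in> I \<rightarrow> carrier A"
  shows "star A (\<Oplus>i\<in>I. f i) = (\<Oplus>i\<in>I. star A (f i))"
  using assms
  by (induction I rule: infinite_finite_induct) (simp_all add: Pi_def star_add)

lemma finsum_swap:
  assumes "finite I" "\<And>i j. i \<in> I \<Longrightarrow> j \<in> J \<Longrightarrow> f i j \<in> carrier A"
  shows "(\<Oplus>i\<in>I. \<Oplus>j\<in>J. f i j) = (\<Oplus>j\<in>J. \<Oplus>i\<in>I. f i j)"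
  using assms
proof (induction I rule: finite_induct)
  case (insert i I)
  then have "(\<Oplus>i\<in>insert i I. \<Oplus>j\<in>J. f i j) = (\<Oplus>j\<in>J. f i j) \<oplus> (\<Oplus>j\<in>J. \<Oplus>i\<in>I. f i j)"
    by (subst finsum_insert) (auto intro!: finsum_closed)
  also have "\<dots> = (\<Oplus>j\<in>J. f i j \<oplus> (\<Oplus>i\<in>I. f i j))"
    using insert by (subst finsum_addf) (auto intro!: finsum_closed)
  also have "\<dots> = (\<Oplus>j\<in>J. \<Oplus>i\<in>insert i I. f i j)"
    using insert by (intro finsum_cong') (auto intro!: finsum_closed)
  finally show ?case .
qed simp

lemma finsum_Times:
  assumes "finite I" "finite J" "\<And>i j. i \<in> I \<Longrightarrow> j \<in> J \<Longrightarrow> f (i, j) \<in> carrier A"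
  shows "(\<Oplus>x\<in>I \<times> J. f x) = (\<Oplus>i\<in>I. \<Oplus>j\<in>J. f (i, j))"
  using assms
proof (induction I rule: finite_induct)
  case (insert i I)
  have eq: "insert i I \<times> J = Pair i ` J \<union> I \<times> J" by auto
  have "(\<Oplus>x\<in>insert i I \<times> J. f x) = (\<Oplus>x\<in>Pair i ` J. f x) \<oplus> (\<Oplus>x\<in>I \<times> J. f x)"
    unfolding eq using insert by (intro finsum_Un_disjoint) auto
  also have "(\<Oplus>x\<in>Pair i ` J. f x) = (\<Oplus>j\<in>J. f (i, j))"
    using insert by (intro finsum_reindex) (auto intro: inj_onI)
  also have "(\<Oplus>x\<in>I \<times> J. f x) = (\<Oplus>i\<in>I. \<Oplus>j\<in>J. f (i, j))"
    using insert by simp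
  finally show ?case
    using insert by (subst finsum_insert) (auto intro!: finsum_closed)
qed simp

lemma finsum_delta:
  assumes "finite I" "i \<in> I" "f \<in> I \<rightarrow> carrier A"
  shows "(\<Oplus>j\<in>I. (if j = i then 1 else 0) \<odot> f j) = f i"
proof -
  have "(\<Oplus>j\<in>I. (if j = i then 1 else 0) \<odot> f j) = (\<Oplus>j\<in>I. if j = i then f j else \<zero>)"
    using assms by (intro finsum_cong') (auto simp: Pi_def)
  then show ?thesis using add.finprod_singleton_swap[OF assms(2,1,3)] by simp
qed

section \<open>Matrices over a star-algebra\<close>

text \<open>Matrices are functions of two indices; only their values on given index sets matter, so
  equations between matrices are stated entrywise on these sets.\<close>

definition mat_mult :: "'i set \<Rightarrow> ('h \<Rightarrow> 'i \<Rightarrow> 'a) \<Rightarrow> ('i \<Rightarrow> 'j \<Rightarrow> 'a) \<Rightarrow> 'h \<Rightarrow> 'j \<Rightarrow> 'a" where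
  "mat_mult I M N = (\<lambda>h j. \<Oplus>i\<in>I. M h i \<otimes> N i j)"

definition scalar_mat :: "('i \<Rightarrow> 'j \<Rightarrow> complex) \<Rightarrow> 'i \<Rightarrow> 'j \<Rightarrow> 'a" where
  "scalar_mat T = (\<lambda>i j. T i j \<odot> \<one>)"

definition adjoint_mat :: "('i \<Rightarrow> 'j \<Rightarrow> 'a) \<Rightarrow> 'j \<Rightarrow> 'i \<Rightarrow> 'a" where
  "adjoint_mat M = (\<lambda>j i. star A (M i j))"

abbreviation matrices :: "'i set \<Rightarrow> 'j set \<Rightarrow> ('i \<Rightarrow> 'j \<Rightarrow> 'a) set" where
  "matrices I J \<equiv> I \<rightarrow> J \<rightarrow> carrier A"

lemma mat_mult_closed: "M \<in> matrices H I \<Longrightarrow> N \<in> matrices I J \<Longrightarrow> mat_mult I M N \<in> matrices H J"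
  unfolding mat_mult_def by (intro Pi_I finsum_closed) (auto simp: Pi_iff)

lemma scalar_mat_closed [simp]: "scalar_mat T \<in> matrices I J"
  by (simp add: scalar_mat_def)

lemma adjoint_mat_closed: "M \<in> matrices I J \<Longrightarrow> adjoint_mat M \<in> matrices J I"
  by (auto simp: adjoint_mat_def Pi_iff)

lemma mat_mult_cong:
  assumes "M' \<in> matrices H I" "N' \<in> matrices I J" "h \<in> H" "j \<in> J"
    and "\<And>i. i \<in> I \<Longrightarrow> M h i = M' h i" "\<And>i. i \<in> I \<Longrightarrow> N i j = N' i j"
  shows "mat_mult I M N h j = mat_mult I M' N' h j"
  unfolding mat_mult_def using assms by (intro finsum_cong') (auto simp: Pi_iff)

lemma mat_mult_assoc:
  assumes fin: "finite I" "finite J"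
    and M: "M \<in> matrices H I" and N: "N \<in> matrices I J" and P: "P \<in> matrices J K"
    and h: "h \<in> H" and k: "k \<in> K"
  shows "mat_mult J (mat_mult I M N) P h k = mat_mult I M (mat_mult J N P) h k"
proof -
  have c: "\<And>i. i \<in> I \<Longrightarrow> M h i \<in> carrier A" "\<And>i j. i \<in> I \<Longrightarrow> j \<in> J \<Longrightarrow> N i j \<in> carrier A"
    "\<And>j. j \<in> J \<Longrightarrow> P j k \<in> carrier A"
    using M N P h k by (auto simp: Pi_iff)
  have "mat_mult J (mat_mult I M N) P h k = (\<Oplus>j\<in>J. (\<Oplus>i\<in>I. M h i \<otimes> N i j) \<otimes> P j k)"
    by (simp add: mat_mult_def)
  also have "\<dots> = (\<Oplus>j\<in>J. \<Oplus>i\<in>I. M h i \<otimes> N i j \<otimes> P j k)"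
    using c fin by (intro finsum_cong' finsum_ldistr) (auto intro!: finsum_closed)
  also have "\<dots> = (\<Oplus>i\<in>I. \<Oplus>j\<in>J. M h i \<otimes> N i j \<otimes> P j k)"
    using c fin by (intro finsum_swap) auto
  also have "\<dots> = (\<Oplus>i\<in>I. \<Oplus>j\<in>J. M h i \<otimes> (N i j \<otimes> P j k))"
    using c by (intro finsum_cong' refl m_assoc Pi_I finsum_closed) auto
  also have "\<dots> = (\<Oplus>i\<in>I. M h i \<otimes> (\<Oplus>j\<in>J. N i j \<otimes> P j k))"
    using c fin by (intro finsum_cong' refl finsum_rdistr[symmetric] Pi_I m_closed finsum_closed) auto
  finally show ?thesis by (simp add: mat_mult_def)
qed

lemma mat_mult_scalar_left:
  assumes "N \<in> matrices I J" "j \<in> J"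
  shows "mat_mult I (scalar_mat T) N h j = (\<Oplus>i\<in>I. T h i \<odot> N i j)"
  unfolding mat_mult_def scalar_mat_def
  using assms by (intro finsum_cong') (auto simp: Pi_iff mult_smult_left)

lemma mat_mult_scalar_right:
  assumes "M \<in> matrices H I" "h \<in> H"
  shows "mat_mult I M (scalar_mat T) h j = (\<Oplus>i\<in>I. T i j \<odot> M h i)"
  unfolding mat_mult_def scalar_mat_def
  using assms by (intro finsum_cong') (auto simp: Pi_iff mult_smult_right)

lemma mat_mult_scalar_scalar:
  "mat_mult I (scalar_mat S) (scalar_mat T) = scalar_mat (\<lambda>h j. \<Sum>i\<in>I. S h i * T i j)"
proof (intro ext)
  fix h j
  have "mat_mult I (scalar_mat S) (scalar_mat T) h j = (\<Oplus>i\<in>I. (S h i * T i j) \<odot> \<one>)"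
    unfolding mat_mult_def scalar_mat_def
    by (intro finsum_cong') (auto simp: mult_smult_left smult_smult)
  also have "\<dots> = scalar_mat (\<lambda>h j. \<Sum>i\<in>I. S h i * T i j) h j"
    by (simp add: scalar_mat_def smult_sum_left)
  finally show "mat_mult I (scalar_mat S) (scalar_mat T) h j = \<dots>" .
qed

abbreviation identity_mat :: "'i \<Rightarrow> 'i \<Rightarrow> 'a" where
  "identity_mat \<equiv> scalar_mat (\<lambda>i j. if i = j then 1 else 0)"

lemma mat_mult_identity_left:
  assumes "finite I" "N \<in> matrices I J" "i \<in> I" "j \<in> J"
  shows "mat_mult I identity_mat N i j = N i j"
  using assms finsum_delta[of I i "\<lambda>h. N h j"]
  by (subst mat_mult_scalar_left) (auto simp: Pi_iff eq_commute)

lemma mat_mult_identity_right: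
  assumes "finite I" "M \<in> matrices H I" "h \<in> H" "i \<in> I"
  shows "mat_mult I M identity_mat h i = M h i"
  using assms finsum_delta[of I i "M h"]
  by (subst mat_mult_scalar_right) (auto simp: Pi_iff)

lemma adjoint_mat_mult:
  assumes "M \<in> matrices H I" "N \<in> matrices I J" "h \<in> H" "j \<in> J"
  shows "adjoint_mat (mat_mult I M N) j h = mat_mult I (adjoint_mat N) (adjoint_mat M) j h"
proof -
  have "star A (\<Oplus>i\<in>I. M h i \<otimes> N i j) = (\<Oplus>i\<in>I. star A (M h i \<otimes> N i j))"
    using assms by (intro star_finsum) (auto simp: Pi_iff)
  also have "\<dots> = (\<Oplus>i\<in>I. star A (N i j) \<otimes> star A (M h i))"
    using assms by (intro finsum_cong') (auto simp: Pi_iff star_mult)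
  finally show ?thesis by (simp add: adjoint_mat_def mat_mult_def)
qed

lemma adjoint_scalar_mat: "adjoint_mat (scalar_mat T) = scalar_mat (\<lambda>j i. cnj (T i j))"
  by (simp add: adjoint_mat_def scalar_mat_def star_smult)

lemma adjoint_adjoint: "M \<in> matrices I J \<Longrightarrow> i \<in> I \<Longrightarrow> j \<in> J \<Longrightarrow> adjoint_mat (adjoint_mat M) i j = M i j"
  by (auto simp: adjoint_mat_def Pi_iff)

end

context unital_star_algebra
begin

lemma monomial_closed:
  assumes "\<And>i j. i \<in> {1..n} \<Longrightarrow> j \<in> {1..n} \<Longrightarrow> u i j \<in> carrier A"
  shows "i \<in> multi_indices n k \<Longrightarrow> j \<in> multi_indices n k \<Longrightarrow> monomial A u i j \<in> carrier A"
proof (induction k arbitrary: i j)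
  case 0
  then show ?case by (simp add: multi_indices_0 monomial_def)
next
  case (Suc k)
  with assms show ?case by (auto simp: multi_indices_Suc monomial_def)
qed

lemma finsum_mult_finsum:
  assumes "finite I" "finite J" "f \<in> I \<rightarrow> carrier A" "g \<in> J \<rightarrow> carrier A"
  shows "(\<Oplus>i\<in>I. f i) \<otimes> (\<Oplus>j\<in>J. g j) = (\<Oplus>i\<in>I. \<Oplus>j\<in>J. f i \<otimes> g j)"
proof -
  have "(\<Oplus>i\<in>I. f i) \<otimes> (\<Oplus>j\<in>J. g j) = (\<Oplus>i\<in>I. f i \<otimes> (\<Oplus>j\<in>J. g j))"
    using assms by (intro finsum_ldistr finsum_closed)
  also have "\<dots> = (\<Oplus>i\<in>I. \<Oplus>j\<in>J. f i \<otimes> g j)"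
    using assms by (intro finsum_cong' refl finsum_rdistr Pi_I finsum_closed m_closed) (auto simp: Pi_iff)
  finally show ?thesis .
qed

lemma finsum_multi_indices_Suc:
  assumes "\<And>a i. a \<in> {1..n} \<Longrightarrow> i \<in> multi_indices n k \<Longrightarrow> f (a # i) \<in> carrier A"
  shows "(\<Oplus>i\<in>multi_indices n (Suc k). f i) = (\<Oplus>a\<in>{1..n}. \<Oplus>i\<in>multi_indices n k. f (a # i))"
proof -
  have "(\<Oplus>i\<in>multi_indices n (Suc k). f i) =
      (\<Oplus>x\<in>{1..n} \<times> multi_indices n k. f (case x of (a, i) \<Rightarrow> a # i))"
    unfolding multi_indices_Suc
    by (rule finsum_reindex) (use assms in \<open>auto simp: inj_on_def\<close>)
  also have "\<dots> = (\<Oplus>a\<in>{1..n}. \<Oplus>i\<in>multi_indices n k. f (a # i))"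
    by (subst finsum_Times) (use assms in auto)
  finally show ?thesis .
qed

lemma finsum_multi_indices_add:
  assumes "\<And>i j. i \<in> multi_indices n k \<Longrightarrow> j \<in> multi_indices n l \<Longrightarrow> f (i @ j) \<in> carrier A"
  shows "(\<Oplus>i\<in>multi_indices n (k + l). f i) =
         (\<Oplus>i\<in>multi_indices n k. \<Oplus>j\<in>multi_indices n l. f (i @ j))"
proof -
  have "(\<Oplus>i\<in>multi_indices n (k + l). f i) =
      (\<Oplus>x\<in>multi_indices n k \<times> multi_indices n l. f (case x of (i, j) \<Rightarrow> i @ j))"
    unfolding multi_indices_add
    by (rule finsum_reindex) (use assms in \<open>auto simp: inj_on_def multi_indices_def\<close>)
  also have "\<dots> = (\<Oplus>i\<in>multi_indices n k. \<Oplus>j\<in>multi_indices n l. f (i @ j))"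
    by (subst finsum_Times) (use assms in auto)
  finally show ?thesis .
qed

lemma finsum_multi_indices_rev:
  assumes "f \<in> multi_indices n k \<rightarrow> carrier A"
  shows "(\<Oplus>i\<in>multi_indices n k. f (rev i)) = (\<Oplus>i\<in>multi_indices n k. f i)"
  using finsum_reindex[of f rev "multi_indices n k"] assms
  by (simp add: rev_multi_indices inj_on_def)

end

section \<open>Intertwiners of the tensor powers of a matrix of self-adjoint elements\<close>

locale selfadjoint_generators = unital_star_algebra A
  for A :: "('a, 'b) star_algebra_scheme" (structure) +
  fixes n :: nat and u :: "nat \<Rightarrow> nat \<Rightarrow> 'a"
  assumes u_closed: "\<lbrakk>a \<in> {1..n}; b \<in> {1..n}\<rbrakk> \<Longrightarrow> u a b \<in> carrier A"
    and star_u: "\<lbrakk>a \<in> {1..n}; b \<in> {1..n}\<rbrakk> \<Longrightarrow> star A (u a b) = u a b"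
begin

abbreviation indices :: "nat \<Rightarrow> nat list set" where
  "indices k \<equiv> multi_indices n k"

abbreviation U :: "nat list \<Rightarrow> nat list \<Rightarrow> 'a" where
  "U \<equiv> monomial A u"

lemma U_Nil: "U [] [] = \<one>"
  by (simp add: monomial_def)

lemma U_Cons: "U (a # i) (b # j) = u a b \<otimes> U i j"
  by (simp add: monomial_def)

lemma indices_Suc_cases:
  assumes "i \<in> indices (Suc k)"
  obtains a i' where "i = a # i'" "a \<in> {1..n}" "i' \<in> indices k"
  using assms by (auto simp: multi_indices_Suc)

lemma U_closed: "i \<in> indices k \<Longrightarrow> j \<in> indices k \<Longrightarrow> U i j \<in> carrier A"
  using u_closed by (rule monomial_closed)

lemma U_matrix: "U \<in> matrices (indices k) (indices k)"
  by (intro Pi_I U_closed)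

lemma U_append:
  assumes "i \<in> indices k" "j \<in> indices k" "i' \<in> indices l" "j' \<in> indices l"
  shows "U (i @ i') (j @ j') = U i j \<otimes> U i' j'"
  using assms(1,2)
proof (induction k arbitrary: i j)
  case 0
  then show ?case using U_closed[OF assms(3,4)] by (simp add: multi_indices_0 U_Nil)
next
  case (Suc k)
  then show ?case using U_closed[OF assms(3,4)]
    by (auto elim!: indices_Suc_cases simp: U_Cons u_closed U_closed m_assoc)
qed

lemma star_U: "i \<in> indices k \<Longrightarrow> j \<in> indices k \<Longrightarrow> star A (U i j) = U (rev i) (rev j)"
proof (induction k arbitrary: i j)
  case 0
  then show ?case by (simp add: multi_indices_0 U_Nil)
next
  case (Suc k)
  from Suc.prems obtain a i' b j' where *: "i = a # i'" "j = b # j'" "a \<in> {1..n}" "b \<in> {1..n}"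
    "i' \<in> indices k" "j' \<in> indices k"
    by (metis indices_Suc_cases)
  have "U (rev i' @ [a]) (rev j' @ [b]) = U (rev i') (rev j') \<otimes> U [a] [b]"
    using * by (intro U_append[where k = k and l = 1]) (auto simp: multi_indices_def)
  then show ?case
    using * Suc.IH[of i' j'] by (simp add: U_Cons U_Nil star_mult star_u u_closed U_closed)
qed

text \<open>The matrix \<open>T\<close>, with rows indexed by \<open>indices l\<close> and columns by \<open>indices k\<close>, satisfies
  \<open>T U\<^sub>k = U\<^sub>l T\<close>, where \<open>U\<^sub>k\<close> is the matrix of the monomials of degree \<open>k\<close>, that is,
  the \<open>k\<close>-th tensor power of the matrix \<open>u\<close>.\<close>

definition intertwines :: "nat \<Rightarrow> nat \<Rightarrow> (nat list \<Rightarrow> nat list \<Rightarrow> complex) \<Rightarrow> bool" where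
  "intertwines k l T \<longleftrightarrow> (\<forall>\<beta>\<in>indices l. \<forall>\<alpha>\<in>indices k.
     mat_mult (indices k) (scalar_mat T) U \<beta> \<alpha> = mat_mult (indices l) U (scalar_mat T) \<beta> \<alpha>)"

lemma intertwines_iff_sums:
  "intertwines k l T \<longleftrightarrow> (\<forall>\<beta>\<in>indices l. \<forall>\<alpha>\<in>indices k.
     (\<Oplus>\<gamma>\<in>indices k. T \<beta> \<gamma> \<odot> U \<gamma> \<alpha>) = (\<Oplus>\<gamma>\<in>indices l. T \<gamma> \<alpha> \<odot> U \<beta> \<gamma>))"
  unfolding intertwines_def
  by (intro ball_cong refl) (simp only: mat_mult_scalar_left[OF U_matrix] mat_mult_scalar_right[OF U_matrix])

text \<open>The relations \<open>R(p)\<close> are thus one matrix equation for \<open>T\<^sub>p\<close>, whose entry in row \<open>\<beta>\<close> and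
  column \<open>\<alpha>\<close> is \<open>\<delta>\<^sub>p(\<alpha>, \<beta>)\<close>.\<close>

lemma fulfills_R_iff_intertwines:
  "fulfills_R A n u k l p \<longleftrightarrow> intertwines k l (\<lambda>\<beta> \<alpha>. delta p \<alpha> \<beta>)"
  unfolding fulfills_R_def intertwines_iff_sums rel_lhs_def rel_rhs_def using star_u by blast

lemma intertwines_cong:
  assumes "intertwines k l T" "\<And>\<beta> \<alpha>. \<beta> \<in> indices l \<Longrightarrow> \<alpha> \<in> indices k \<Longrightarrow> S \<beta> \<alpha> = T \<beta> \<alpha>"
  shows "intertwines k l S"
  unfolding intertwines_iff_sums
proof (intro ballI)
  fix \<beta> \<alpha> assume *: "\<beta> \<in> indices l" "\<alpha> \<in> indices k"
  have "(\<Oplus>\<gamma>\<in>indices k. S \<beta> \<gamma> \<odot> U \<gamma> \<alpha>) = (\<Oplus>\<gamma>\<in>indices k. T \<beta> \<gamma> \<odot> U \<gamma> \<alpha>)"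
    using assms(2) * by (intro finsum_cong') (auto intro: U_closed)
  also have "\<dots> = (\<Oplus>\<gamma>\<in>indices l. T \<gamma> \<alpha> \<odot> U \<beta> \<gamma>)"
    using assms(1) * by (simp add: intertwines_iff_sums)
  also have "\<dots> = (\<Oplus>\<gamma>\<in>indices l. S \<gamma> \<alpha> \<odot> U \<beta> \<gamma>)"
    using assms(2) * by (intro finsum_cong') (auto intro: U_closed)
  finally show "(\<Oplus>\<gamma>\<in>indices k. S \<beta> \<gamma> \<odot> U \<gamma> \<alpha>) = (\<Oplus>\<gamma>\<in>indices l. S \<gamma> \<alpha> \<odot> U \<beta> \<gamma>)" .
qed

lemma intertwines_cancel_scalar:
  assumes "intertwines k l (\<lambda>\<beta> \<alpha>. c * T \<beta> \<alpha>)" "c \<noteq> 0"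
  shows "intertwines k l T"
  unfolding intertwines_iff_sums
proof (intro ballI)
  fix \<beta> \<alpha> assume *: "\<beta> \<in> indices l" "\<alpha> \<in> indices k"
  let ?L = "\<Oplus>\<gamma>\<in>indices k. T \<beta> \<gamma> \<odot> U \<gamma> \<alpha>" and ?R = "\<Oplus>\<gamma>\<in>indices l. T \<gamma> \<alpha> \<odot> U \<beta> \<gamma>"
  have closed: "?L \<in> carrier A" "?R \<in> carrier A"
    using * by (auto intro!: finsum_closed U_closed)
  have "c \<odot> ?L = (\<Oplus>\<gamma>\<in>indices k. c \<odot> (T \<beta> \<gamma> \<odot> U \<gamma> \<alpha>))"
    using * by (intro finsum_smult) (auto intro: U_closed)
  also have "\<dots> = (\<Oplus>\<gamma>\<in>indices k. (c * T \<beta> \<gamma>) \<odot> U \<gamma> \<alpha>)"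
    using * by (intro finsum_cong' refl smult_smult) (auto intro: U_closed)
  also have "\<dots> = (\<Oplus>\<gamma>\<in>indices l. (c * T \<gamma> \<alpha>) \<odot> U \<beta> \<gamma>)"
    using assms(1) * by (simp add: intertwines_iff_sums)
  also have "\<dots> = (\<Oplus>\<gamma>\<in>indices l. c \<odot> (T \<gamma> \<alpha> \<odot> U \<beta> \<gamma>))"
    using * by (intro finsum_cong' refl smult_smult[symmetric]) (auto intro: U_closed)
  also have "\<dots> = c \<odot> ?R"
    using * by (intro finsum_smult[symmetric]) (auto intro: U_closed)
  finally have "(1 / c) \<odot> (c \<odot> ?L) = (1 / c) \<odot> (c \<odot> ?R)" by simp
  then show "?L = ?R"
    using closed assms(2) by (simp only: smult_smult) simp
qed

lemma intertwines_identity: "intertwines k k (\<lambda>\<beta> \<alpha>. if \<beta> = \<alpha> then 1 else 0)"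
  unfolding intertwines_def
  by (simp add: mat_mult_identity_left[OF _ U_matrix] mat_mult_identity_right[OF _ U_matrix])

text \<open>\<open>S T U\<^sub>k = S U\<^sub>l T = U\<^sub>m S T\<close>.\<close>

lemma intertwines_compose:
  assumes T: "intertwines k l T" and S: "intertwines l m S"
  shows "intertwines k m (\<lambda>\<beta> \<alpha>. \<Sum>\<gamma>\<in>indices l. S \<beta> \<gamma> * T \<gamma> \<alpha>)"
  unfolding intertwines_def
proof (intro ballI)
  fix \<beta> \<alpha> assume \<beta>: "\<beta> \<in> indices m" and \<alpha>: "\<alpha> \<in> indices k"
  let ?T = "scalar_mat T :: nat list \<Rightarrow> nat list \<Rightarrow> 'a"
    and ?S = "scalar_mat S :: nat list \<Rightarrow> nat list \<Rightarrow> 'a"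
  note closed = U_matrix scalar_mat_closed mat_mult_closed[OF U_matrix scalar_mat_closed]
    mat_mult_closed[OF scalar_mat_closed U_matrix]
  have "mat_mult (indices k) (mat_mult (indices l) ?S ?T) U \<beta> \<alpha> =
      mat_mult (indices l) ?S (mat_mult (indices k) ?T U) \<beta> \<alpha>"
    using \<beta> \<alpha> by (intro mat_mult_assoc[where H = "indices m" and K = "indices k"] closed) auto
  also have "\<dots> = mat_mult (indices l) ?S (mat_mult (indices l) U ?T) \<beta> \<alpha>"
    using \<beta> \<alpha> T unfolding intertwines_def
    by (intro mat_mult_cong[where H = "indices m" and J = "indices k"] closed) auto
  also have "\<dots> = mat_mult (indices l) (mat_mult (indices l) ?S U) ?T \<beta> \<alpha>"
    using \<beta> \<alpha> by (intro mat_mult_assoc[where H = "indices m" and K = "indices k", symmetric] closed) auto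
  also have "\<dots> = mat_mult (indices l) (mat_mult (indices m) U ?S) ?T \<beta> \<alpha>"
    using \<beta> \<alpha> S unfolding intertwines_def
    by (intro mat_mult_cong[where H = "indices m" and J = "indices k"] closed) auto
  also have "\<dots> = mat_mult (indices m) U (mat_mult (indices l) ?S ?T) \<beta> \<alpha>"
    using \<beta> \<alpha> by (intro mat_mult_assoc[where H = "indices m" and K = "indices k"] closed) auto
  finally show "mat_mult (indices k) (scalar_mat (\<lambda>\<beta> \<alpha>. \<Sum>\<gamma>\<in>indices l. S \<beta> \<gamma> * T \<gamma> \<alpha>)) U \<beta> \<alpha> =
      mat_mult (indices m) U (scalar_mat (\<lambda>\<beta> \<alpha>. \<Sum>\<gamma>\<in>indices l. S \<beta> \<gamma> * T \<gamma> \<alpha>)) \<beta> \<alpha>"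
    unfolding mat_mult_scalar_scalar .
qed

text \<open>The matrix \<open>U\<close> of degree \<open>k + k'\<close> is the tensor product of those of degrees \<open>k\<close> and
  \<open>k'\<close>, so each side for \<open>R\<close> is the product of the corresponding sides for \<open>T\<close> and \<open>S\<close>.\<close>

lemma intertwines_tensor:
  assumes T: "intertwines k l T" and S: "intertwines k' l' S"
    and R: "\<And>\<beta> \<alpha> \<beta>' \<alpha>'. \<lbrakk>\<beta> \<in> indices l; \<alpha> \<in> indices k; \<beta>' \<in> indices l'; \<alpha>' \<in> indices k'\<rbrakk> \<Longrightarrow>
      R (\<beta> @ \<beta>') (\<alpha> @ \<alpha>') = T \<beta> \<alpha> * S \<beta>' \<alpha>'"
  shows "intertwines (k + k') (l + l') R"
  unfolding intertwines_iff_sums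
proof (intro ballI)
  fix \<epsilon> \<phi> assume "\<epsilon> \<in> indices (l + l')" "\<phi> \<in> indices (k + k')"
  then obtain \<beta> \<beta>' \<alpha> \<alpha>' where \<epsilon>: "\<epsilon> = \<beta> @ \<beta>'" and \<phi>: "\<phi> = \<alpha> @ \<alpha>'"
    and *: "\<beta> \<in> indices l" "\<beta>' \<in> indices l'" "\<alpha> \<in> indices k" "\<alpha>' \<in> indices k'"
    by (auto simp: multi_indices_add)
  have "(\<Oplus>\<gamma>\<in>indices (k + k'). R \<epsilon> \<gamma> \<odot> U \<gamma> \<phi>) =
      (\<Oplus>\<gamma>\<in>indices k. \<Oplus>\<gamma>'\<in>indices k'. R \<epsilon> (\<gamma> @ \<gamma>') \<odot> U (\<gamma> @ \<gamma>') \<phi>)"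
    using * unfolding \<phi>
    by (intro finsum_multi_indices_add) (auto simp: U_append U_closed)
  also have "\<dots> = (\<Oplus>\<gamma>\<in>indices k. \<Oplus>\<gamma>'\<in>indices k'. (T \<beta> \<gamma> \<odot> U \<gamma> \<alpha>) \<otimes> (S \<beta>' \<gamma>' \<odot> U \<gamma>' \<alpha>'))"
    using * unfolding \<phi> \<epsilon>
    by (intro finsum_cong' refl)
      (auto intro!: finsum_closed simp: U_closed U_append[where k = k and l = k'] R mult_smult_left mult_smult_right smult_smult mult.commute)
  also have "\<dots> = (\<Oplus>\<gamma>\<in>indices k. T \<beta> \<gamma> \<odot> U \<gamma> \<alpha>) \<otimes> (\<Oplus>\<gamma>'\<in>indices k'. S \<beta>' \<gamma>' \<odot> U \<gamma>' \<alpha>')"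
    using * by (intro finsum_mult_finsum[symmetric]) (auto intro: U_closed)
  also have "\<dots> = (\<Oplus>\<gamma>\<in>indices l. T \<gamma> \<alpha> \<odot> U \<beta> \<gamma>) \<otimes> (\<Oplus>\<gamma>'\<in>indices l'. S \<gamma>' \<alpha>' \<odot> U \<beta>' \<gamma>')"
    using * T S by (simp add: intertwines_iff_sums)
  also have "\<dots> = (\<Oplus>\<gamma>\<in>indices l. \<Oplus>\<gamma>'\<in>indices l'. (T \<gamma> \<alpha> \<odot> U \<beta> \<gamma>) \<otimes> (S \<gamma>' \<alpha>' \<odot> U \<beta>' \<gamma>'))"
    using * by (intro finsum_mult_finsum) (auto intro: U_closed)
  also have "\<dots> = (\<Oplus>\<gamma>\<in>indices l. \<Oplus>\<gamma>'\<in>indices l'. R (\<gamma> @ \<gamma>') \<phi> \<odot> U \<epsilon> (\<gamma> @ \<gamma>'))"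
    using * unfolding \<phi> \<epsilon>
    by (intro finsum_cong' refl)
      (auto intro!: finsum_closed simp: U_closed U_append[where k = l and l = l'] R mult_smult_left mult_smult_right smult_smult mult.commute)
  also have "\<dots> = (\<Oplus>\<gamma>\<in>indices (l + l'). R \<gamma> \<phi> \<odot> U \<epsilon> \<gamma>)"
    using * unfolding \<epsilon>
    by (intro finsum_multi_indices_add[symmetric]) (auto simp: U_append U_closed)
  finally show "(\<Oplus>\<gamma>\<in>indices (k + k'). R \<epsilon> \<gamma> \<odot> U \<gamma> \<phi>) = (\<Oplus>\<gamma>\<in>indices (l + l'). R \<gamma> \<phi> \<odot> U \<epsilon> \<gamma>)" .
qed

text \<open>Applying the star to the relations reverses the order of the factors in each monomial and
  leaves the factors alone, because they are self-adjoint.\<close>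

lemma intertwines_reverse:
  assumes "intertwines k l T"
  shows "intertwines k l (\<lambda>\<beta> \<alpha>. cnj (T (rev \<beta>) (rev \<alpha>)))"
  unfolding intertwines_iff_sums
proof (intro ballI)
  fix \<beta> \<alpha> assume *: "\<beta> \<in> indices l" "\<alpha> \<in> indices k"
  note [simp] = rev_in_multi_indices
  have "(\<Oplus>\<gamma>\<in>indices k. cnj (T (rev \<beta>) (rev \<gamma>)) \<odot> U \<gamma> \<alpha>) =
      (\<Oplus>\<gamma>\<in>indices k. cnj (T (rev \<beta>) (rev (rev \<gamma>))) \<odot> U (rev \<gamma>) \<alpha>)"
    using * by (intro finsum_multi_indices_rev[symmetric]) (auto simp: U_closed)
  also have "\<dots> = (\<Oplus>\<gamma>\<in>indices k. star A (T (rev \<beta>) \<gamma> \<odot> U \<gamma> (rev \<alpha>)))"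
    using * by (intro finsum_cong') (auto simp: U_closed star_smult star_U)
  also have "\<dots> = star A (\<Oplus>\<gamma>\<in>indices k. T (rev \<beta>) \<gamma> \<odot> U \<gamma> (rev \<alpha>))"
    using * by (intro star_finsum[symmetric]) (auto simp: U_closed)
  also have "\<dots> = star A (\<Oplus>\<gamma>\<in>indices l. T \<gamma> (rev \<alpha>) \<odot> U (rev \<beta>) \<gamma>)"
    using * assms by (simp add: intertwines_iff_sums)
  also have "\<dots> = (\<Oplus>\<gamma>\<in>indices l. star A (T \<gamma> (rev \<alpha>) \<odot> U (rev \<beta>) \<gamma>))"
    using * by (intro star_finsum) (auto simp: U_closed)
  also have "\<dots> = (\<Oplus>\<gamma>\<in>indices l. cnj (T (rev (rev \<gamma>)) (rev \<alpha>)) \<odot> U \<beta> (rev \<gamma>))"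
    using * by (intro finsum_cong') (auto simp: U_closed star_smult star_U)
  also have "\<dots> = (\<Oplus>\<gamma>\<in>indices l. cnj (T (rev \<gamma>) (rev \<alpha>)) \<odot> U \<beta> \<gamma>)"
    using * by (intro finsum_multi_indices_rev) (auto simp: U_closed)
  finally show "(\<Oplus>\<gamma>\<in>indices k. cnj (T (rev \<beta>) (rev \<gamma>)) \<odot> U \<gamma> \<alpha>) =
      (\<Oplus>\<gamma>\<in>indices l. cnj (T (rev \<gamma>) (rev \<alpha>)) \<odot> U \<beta> \<gamma>)" .
qed

end

context selfadjoint_generators
begin

lemma finsum_multi_indices_2:
  assumes "\<And>a b. a \<in> {1..n} \<Longrightarrow> b \<in> {1..n} \<Longrightarrow> f [a, b] \<in> carrier A"
  shows "(\<Oplus>i\<in>indices 2. f i) = (\<Oplus>a\<in>{1..n}. \<Oplus>b\<in>{1..n}. f [a, b])"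
proof -
  have inner: "(\<Oplus>i\<in>indices (Suc 0). f (a # i)) = (\<Oplus>b\<in>{1..n}. f [a, b])" if "a \<in> {1..n}" for a
    using assms that finsum_multi_indices_Suc[of n 0 "\<lambda>i. f (a # i)"]
    by (simp add: multi_indices_0 Pi_def cong: finsum_cong)
  have "(\<Oplus>i\<in>indices 2. f i) = (\<Oplus>a\<in>{1..n}. \<Oplus>i\<in>indices (Suc 0). f (a # i))"
    using assms unfolding numeral_2_eq_2
    by (intro finsum_multi_indices_Suc) (auto simp: multi_indices_Suc multi_indices_0)
  also have "\<dots> = (\<Oplus>a\<in>{1..n}. \<Oplus>b\<in>{1..n}. f [a, b])"
    using assms inner by (intro finsum_cong') (auto intro!: finsum_closed)
  finally show ?thesis .
qed

text \<open>Together with \<open>column_sums_if_cup\<close>, this says that \<open>u\<close> is an orthogonal matrix: the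
  relations of the cap give \<open>u u\<^sup>t = 1\<close>, those of the cup give \<open>u\<^sup>t u = 1\<close>.\<close>

lemma row_sums_if_cap:
  assumes cap: "fulfills_R A n u 0 2 cap_part" and ab: "a \<in> {1..n}" "b \<in> {1..n}"
  shows "(\<Oplus>c\<in>{1..n}. u a c \<otimes> u b c) = (if a = b then 1 else 0) \<odot> \<one>"
proof -
  have ab': "[a, b] \<in> indices 2" using ab by (simp add: multi_indices_def)
  have "(if a = b then 1 else 0) \<odot> \<one> = (\<Oplus>\<gamma>\<in>indices 2. delta cap_part [] \<gamma> \<odot> U [a, b] \<gamma>)"
    using cap ab' unfolding fulfills_R_def rel_lhs_def rel_rhs_def
    by (auto simp: multi_indices_0 delta_cap_part U_Nil)
  also have "\<dots> = (\<Oplus>c\<in>{1..n}. \<Oplus>d\<in>{1..n}. delta cap_part [] [c, d] \<odot> U [a, b] [c, d])"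
    using ab by (intro finsum_multi_indices_2) (auto simp: U_Cons U_Nil u_closed)
  also have "\<dots> = (\<Oplus>c\<in>{1..n}. \<Oplus>d\<in>{1..n}. (if d = c then 1 else 0) \<odot> (u a c \<otimes> u b d))"
    using ab by (intro finsum_cong' refl Pi_I finsum_closed) (auto simp: delta_cap_part U_Cons U_Nil u_closed)
  also have "\<dots> = (\<Oplus>c\<in>{1..n}. u a c \<otimes> u b c)"
    using ab by (intro finsum_cong' finsum_delta) (auto simp: u_closed)
  finally show ?thesis by simp
qed

lemma column_sums_if_cup:
  assumes cup: "fulfills_R A n u 2 0 cup_part" and ab: "a \<in> {1..n}" "b \<in> {1..n}"
  shows "(\<Oplus>c\<in>{1..n}. u c a \<otimes> u c b) = (if a = b then 1 else 0) \<odot> \<one>"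
proof -
  have ab': "[a, b] \<in> indices 2" using ab by (simp add: multi_indices_def)
  have "(if a = b then 1 else 0) \<odot> \<one> = (\<Oplus>\<gamma>\<in>indices 2. delta cup_part \<gamma> [] \<odot> U \<gamma> [a, b])"
    using cup ab' unfolding fulfills_R_def rel_lhs_def rel_rhs_def
    by (auto simp: multi_indices_0 delta_cup_part U_Nil)
  also have "\<dots> = (\<Oplus>c\<in>{1..n}. \<Oplus>d\<in>{1..n}. delta cup_part [c, d] [] \<odot> U [c, d] [a, b])"
    using ab by (intro finsum_multi_indices_2) (auto simp: U_Cons U_Nil u_closed)
  also have "\<dots> = (\<Oplus>c\<in>{1..n}. \<Oplus>d\<in>{1..n}. (if d = c then 1 else 0) \<odot> (u c a \<otimes> u d b))"
    using ab by (intro finsum_cong' refl Pi_I finsum_closed) (auto simp: delta_cup_part U_Cons U_Nil u_closed)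
  also have "\<dots> = (\<Oplus>c\<in>{1..n}. u c a \<otimes> u c b)"
    using ab by (intro finsum_cong' finsum_delta) (auto simp: u_closed)
  finally show ?thesis by simp
qed

lemma finsum_sandwich:
  assumes "finite I" "x \<in> carrier A" "z \<in> carrier A" "f \<in> I \<rightarrow> carrier A"
  shows "(\<Oplus>i\<in>I. x \<otimes> f i \<otimes> z) = x \<otimes> (\<Oplus>i\<in>I. f i) \<otimes> z"
  using assms finsum_rdistr[of I x f] finsum_ldistr[of I z "\<lambda>i. x \<otimes> f i"] by (simp add: Pi_def)

text \<open>Since \<open>star (U j \<gamma>)\<close> has its factors in reversed order, in \<open>U i \<gamma> \<otimes> star (U j \<gamma>)\<close> the last
  letters meet in the middle: the sum over the tail of \<open>\<gamma>\<close> collapses to a scalar by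
  induction, and the outermost letters are then summed with \<open>u u\<^sup>t = 1\<close>.\<close>

lemma U_mult_adjoint:
  assumes cap: "fulfills_R A n u 0 2 cap_part"
  shows "i \<in> indices k \<Longrightarrow> j \<in> indices k \<Longrightarrow>
    mat_mult (indices k) U (adjoint_mat U) i j = identity_mat i j"
proof (induction k arbitrary: i j)
  case 0
  then show ?case
    by (simp add: mat_mult_def adjoint_mat_def scalar_mat_def multi_indices_0 U_Nil)
next
  case (Suc k)
  from Suc.prems obtain a i' b j' where *: "i = a # i'" "j = b # j'" "a \<in> {1..n}" "b \<in> {1..n}"
    "i' \<in> indices k" "j' \<in> indices k"
    by (metis indices_Suc_cases)
  have "(\<Oplus>\<gamma>\<in>indices (Suc k). U i \<gamma> \<otimes> star A (U j \<gamma>)) =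
      (\<Oplus>c\<in>{1..n}. \<Oplus>\<gamma>\<in>indices k. U i (c # \<gamma>) \<otimes> star A (U j (c # \<gamma>)))"
    using * by (intro finsum_multi_indices_Suc) (auto simp: U_Cons u_closed U_closed)
  also have "\<dots> = (\<Oplus>c\<in>{1..n}. \<Oplus>\<gamma>\<in>indices k. u a c \<otimes> (U i' \<gamma> \<otimes> star A (U j' \<gamma>)) \<otimes> u b c)"
    using * by (intro finsum_cong' refl Pi_I finsum_closed)
      (auto simp: U_Cons u_closed U_closed star_mult star_u m_assoc)
  also have "\<dots> = (\<Oplus>c\<in>{1..n}. u a c \<otimes> (\<Oplus>\<gamma>\<in>indices k. U i' \<gamma> \<otimes> star A (U j' \<gamma>)) \<otimes> u b c)"
    using * by (intro finsum_cong' refl finsum_sandwich Pi_I m_closed finsum_closed) (auto simp: u_closed U_closed)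
  also have "\<dots> = (\<Oplus>c\<in>{1..n}. (if i' = j' then 1 else 0) \<odot> (u a c \<otimes> u b c))"
  proof -
    have "(\<Oplus>\<gamma>\<in>indices k. U i' \<gamma> \<otimes> star A (U j' \<gamma>)) = (if i' = j' then 1 else 0) \<odot> \<one>"
      using Suc.IH[OF *(5,6)] unfolding mat_mult_def adjoint_mat_def scalar_mat_def .
    then show ?thesis
      using * by (intro finsum_cong') (auto simp: u_closed mult_smult_left mult_smult_right)
  qed
  also have "\<dots> = (if i' = j' then 1 else 0) \<odot> (\<Oplus>c\<in>{1..n}. u a c \<otimes> u b c)"
    using * by (intro finsum_smult[symmetric]) (auto simp: u_closed)
  also have "\<dots> = identity_mat i j"
    using * by (auto simp: scalar_mat_def row_sums_if_cap[OF cap, unfolded One_nat_def] smult_smult)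
  finally show ?case by (simp add: mat_mult_def adjoint_mat_def)
qed

text \<open>Here it is the first letters that meet in the middle, so the sum over the first letter of
  \<open>\<gamma>\<close> has to be carried out before the induction hypothesis applies.\<close>

lemma adjoint_mult_U:
  assumes cup: "fulfills_R A n u 2 0 cup_part"
  shows "i \<in> indices k \<Longrightarrow> j \<in> indices k \<Longrightarrow>
    mat_mult (indices k) (adjoint_mat U) U i j = identity_mat i j"
proof (induction k arbitrary: i j)
  case 0
  then show ?case
    by (simp add: mat_mult_def adjoint_mat_def scalar_mat_def multi_indices_0 U_Nil)
next
  case (Suc k)
  from Suc.prems obtain a i' b j' where *: "i = a # i'" "j = b # j'" "a \<in> {1..n}" "b \<in> {1..n}"
    "i' \<in> indices k" "j' \<in> indices k"
    by (metis indices_Suc_cases)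
  have "(\<Oplus>\<gamma>\<in>indices (Suc k). star A (U \<gamma> i) \<otimes> U \<gamma> j) =
      (\<Oplus>c\<in>{1..n}. \<Oplus>\<gamma>\<in>indices k. star A (U (c # \<gamma>) i) \<otimes> U (c # \<gamma>) j)"
    using * by (intro finsum_multi_indices_Suc) (auto simp: U_Cons u_closed U_closed)
  also have "\<dots> = (\<Oplus>\<gamma>\<in>indices k. \<Oplus>c\<in>{1..n}. star A (U (c # \<gamma>) i) \<otimes> U (c # \<gamma>) j)"
    using * by (intro finsum_swap) (auto simp: U_Cons u_closed U_closed)
  also have "\<dots> = (\<Oplus>\<gamma>\<in>indices k. \<Oplus>c\<in>{1..n}. star A (U \<gamma> i') \<otimes> (u c a \<otimes> u c b) \<otimes> U \<gamma> j')"
    using * by (intro finsum_cong' refl Pi_I finsum_closed)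
      (auto simp: U_Cons u_closed U_closed star_mult star_u m_assoc)
  also have "\<dots> = (\<Oplus>\<gamma>\<in>indices k. star A (U \<gamma> i') \<otimes> (\<Oplus>c\<in>{1..n}. u c a \<otimes> u c b) \<otimes> U \<gamma> j')"
    using * by (intro finsum_cong' refl finsum_sandwich Pi_I m_closed finsum_closed) (auto simp: u_closed U_closed)
  also have "\<dots> = (\<Oplus>\<gamma>\<in>indices k. (if a = b then 1 else 0) \<odot> (star A (U \<gamma> i') \<otimes> U \<gamma> j'))"
    using * by (intro finsum_cong')
      (auto simp: column_sums_if_cup[OF cup, unfolded One_nat_def] U_closed mult_smult_left mult_smult_right)
  also have "\<dots> = (if a = b then 1 else 0) \<odot> (\<Oplus>\<gamma>\<in>indices k. star A (U \<gamma> i') \<otimes> U \<gamma> j')"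
    using * by (intro finsum_smult[symmetric]) (auto simp: U_closed)
  also have "\<dots> = identity_mat i j"
    using * Suc.IH[OF *(5,6)] by (auto simp: scalar_mat_def mat_mult_def adjoint_mat_def smult_smult)
  finally show ?case by (simp add: mat_mult_def adjoint_mat_def)
qed

text \<open>If \<open>U\<^sub>k\<close> and \<open>U\<^sub>l\<close> are unitary, multiplying \<open>T U\<^sub>k = U\<^sub>l T\<close> by \<open>U\<^sub>l\<^sup>*\<close> on the left and by
  \<open>U\<^sub>k\<^sup>*\<close> on the right gives \<open>U\<^sub>l\<^sup>* T = T U\<^sub>k\<^sup>*\<close>, whose adjoint is \<open>T\<^sup>* U\<^sub>l = U\<^sub>k T\<^sup>*\<close>.\<close>

lemma intertwines_adjoint:
  assumes cap: "fulfills_R A n u 0 2 cap_part" and cup: "fulfills_R A n u 2 0 cup_part"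
    and T: "intertwines k l T"
  shows "intertwines l k (\<lambda>\<alpha> \<beta>. cnj (T \<beta> \<alpha>))"
proof -
  let ?T = "scalar_mat T :: nat list \<Rightarrow> nat list \<Rightarrow> 'a"
  let ?V = "adjoint_mat U"
  let ?K = "indices k" and ?L = "indices l"
  have V_closed: "?V i j \<in> carrier A" if "i \<in> indices m" "j \<in> indices m" for i j m
    using that by (simp add: adjoint_mat_def U_closed)
  note closed = U_matrix scalar_mat_closed adjoint_mat_closed[OF U_matrix] mat_mult_closed
  have VT: "mat_mult ?L ?V ?T \<beta> \<alpha> = mat_mult ?K ?T ?V \<beta> \<alpha>" if \<beta>: "\<beta> \<in> ?L" and \<alpha>: "\<alpha> \<in> ?K" for \<beta> \<alpha>
  proof -
    note cong = mat_mult_cong[where H = ?L and J = ?K] and assoc = mat_mult_assoc[where H = ?L and K = ?K]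
    have "mat_mult ?L ?V ?T \<beta> \<alpha> = mat_mult ?K (mat_mult ?L ?V ?T) identity_mat \<beta> \<alpha>"
      using \<beta> \<alpha> by (intro mat_mult_identity_right[symmetric] closed) (auto intro: V_closed)
    also have "\<dots> = mat_mult ?K (mat_mult ?L ?V ?T) (mat_mult ?K U ?V) \<beta> \<alpha>"
      using \<beta> \<alpha> U_mult_adjoint[OF cap] by (intro cong closed) (auto intro: V_closed)
    also have "\<dots> = mat_mult ?L ?V (mat_mult ?K ?T (mat_mult ?K U ?V)) \<beta> \<alpha>"
      using \<beta> \<alpha> by (intro assoc closed) (auto intro: V_closed)
    also have "\<dots> = mat_mult ?L ?V (mat_mult ?K (mat_mult ?K ?T U) ?V) \<beta> \<alpha>"
      using \<beta> \<alpha> by (intro cong assoc[symmetric] closed) (auto intro: V_closed)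
    also have "\<dots> = mat_mult ?L ?V (mat_mult ?K (mat_mult ?L U ?T) ?V) \<beta> \<alpha>"
      using \<beta> \<alpha> T unfolding intertwines_def by (intro cong closed) (auto intro: V_closed)
    also have "\<dots> = mat_mult ?L ?V (mat_mult ?L U (mat_mult ?K ?T ?V)) \<beta> \<alpha>"
      using \<beta> \<alpha> by (intro cong assoc closed) (auto intro: V_closed)
    also have "\<dots> = mat_mult ?L (mat_mult ?L ?V U) (mat_mult ?K ?T ?V) \<beta> \<alpha>"
      using \<beta> \<alpha> by (intro assoc[symmetric] closed) (auto intro: V_closed)
    also have "\<dots> = mat_mult ?L identity_mat (mat_mult ?K ?T ?V) \<beta> \<alpha>"
      using \<beta> \<alpha> adjoint_mult_U[OF cup] by (intro cong closed) (auto intro: V_closed)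
    also have "\<dots> = mat_mult ?K ?T ?V \<beta> \<alpha>"
      using \<beta> \<alpha> by (intro mat_mult_identity_left closed) (auto intro: V_closed)
    finally show ?thesis .
  qed
  show ?thesis
    unfolding intertwines_def
  proof (intro ballI)
    fix \<alpha> \<beta> assume \<alpha>: "\<alpha> \<in> ?K" and \<beta>: "\<beta> \<in> ?L"
    have "mat_mult ?L (adjoint_mat ?T) U \<alpha> \<beta> = mat_mult ?L (adjoint_mat ?T) (adjoint_mat ?V) \<alpha> \<beta>"
      using \<alpha> \<beta>
      by (intro mat_mult_cong[where H = ?K and J = ?L] adjoint_mat_closed closed
          adjoint_adjoint[OF U_matrix, symmetric]) (auto intro: V_closed)
    also have "\<dots> = adjoint_mat (mat_mult ?L ?V ?T) \<alpha> \<beta>"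
      using \<alpha> \<beta> by (intro adjoint_mat_mult[symmetric] closed) (auto intro: V_closed)
    also have "\<dots> = adjoint_mat (mat_mult ?K ?T ?V) \<alpha> \<beta>"
      using VT[OF \<beta> \<alpha>] by (simp add: adjoint_mat_def)
    also have "\<dots> = mat_mult ?K (adjoint_mat ?V) (adjoint_mat ?T) \<alpha> \<beta>"
      using \<alpha> \<beta> by (intro adjoint_mat_mult closed) (auto intro: V_closed)
    also have "\<dots> = mat_mult ?K U (adjoint_mat ?T) \<alpha> \<beta>"
      using \<alpha> \<beta>
      by (intro mat_mult_cong[where H = ?K and J = ?L] adjoint_mat_closed closed
          adjoint_adjoint[OF U_matrix]) (auto intro: V_closed)
    finally show "mat_mult ?L (scalar_mat (\<lambda>\<alpha> \<beta>. cnj (T \<beta> \<alpha>))) U \<alpha> \<beta> =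
        mat_mult ?K U (scalar_mat (\<lambda>\<alpha> \<beta>. cnj (T \<beta> \<alpha>))) \<alpha> \<beta>"
      by (simp only: adjoint_scalar_mat)
  qed
qed

section \<open>Closure of the fulfilled relations under the partition operations\<close>

lemma fulfills_R_id_part: "fulfills_R A n u 1 1 id_part"
  unfolding fulfills_R_iff_intertwines
  by (rule intertwines_cong[OF intertwines_identity])
    (auto simp: multi_indices_Suc multi_indices_0 delta_id_part split: if_splits)

lemma fulfills_R_tensor_part:
  assumes "p \<in> Part k l" "fulfills_R A n u k l p" "fulfills_R A n u k' l' q"
  shows "fulfills_R A n u (k + k') (l + l') (tensor_part k l p q)"
  using assms(2,3) unfolding fulfills_R_iff_intertwines
  by (rule intertwines_tensor)
    (use assms(1) in \<open>auto simp: delta_tensor_part multi_indices_def\<close>)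

lemma fulfills_R_compose_part:
  assumes n: "n \<ge> 1" and p: "p \<in> Part k l" and q: "q \<in> Part l m"
    and Rp: "fulfills_R A n u k l p" and Rq: "fulfills_R A n u l m q"
  shows "fulfills_R A n u k m (compose_part k m q p)"
proof -
  obtain c :: complex where c: "c \<noteq> 0"
    "\<And>i j. i \<in> indices k \<Longrightarrow> j \<in> indices m \<Longrightarrow>
       (\<Sum>h\<in>indices l. delta p i h * delta q h j) = c * delta (compose_part k m q p) i j"
    using sum_delta_compose[OF n p q] by blast
  have "intertwines k m (\<lambda>\<beta> \<alpha>. \<Sum>\<gamma>\<in>indices l. delta q \<gamma> \<beta> * delta p \<alpha> \<gamma>)"
    using Rp Rq unfolding fulfills_R_iff_intertwines by (rule intertwines_compose)
  then have "intertwines k m (\<lambda>\<beta> \<alpha>. c * delta (compose_part k m q p) \<alpha> \<beta>)"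
    by (rule intertwines_cong) (simp add: c(2)[symmetric] mult.commute)
  then show ?thesis
    unfolding fulfills_R_iff_intertwines using c(1) by (rule intertwines_cancel_scalar)
qed

lemma fulfills_R_reflection:
  assumes "p \<in> Part k l" "fulfills_R A n u k l p"
  shows "fulfills_R A n u k l (reflection k l p)"
proof -
  have "intertwines k l (\<lambda>\<beta> \<alpha>. cnj (delta p (rev \<alpha>) (rev \<beta>)))"
    using intertwines_reverse assms(2) unfolding fulfills_R_iff_intertwines by blast
  then show ?thesis
    unfolding fulfills_R_iff_intertwines
    by (rule intertwines_cong) (use assms(1) in \<open>simp add: delta_reflection multi_indices_def\<close>)
qed

lemma fulfills_R_involution:
  assumes "fulfills_R A n u 0 2 cap_part" "fulfills_R A n u 2 0 cup_part" "fulfills_R A n u k l p"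
  shows "fulfills_R A n u l k (involution p)"
proof -
  have "intertwines l k (\<lambda>\<alpha> \<beta>. cnj (delta p \<alpha> \<beta>))"
    using intertwines_adjoint[OF assms(1,2)] assms(3) unfolding fulfills_R_iff_intertwines by blast
  then show ?thesis
    unfolding fulfills_R_iff_intertwines by (rule intertwines_cong) (simp add: delta_involution)
qed

end

section \<open>The free star-algebra\<close>

lemma word_adjoint_word_adjoint [simp]:
  fixes w :: "'g word"
  shows "word_adjoint (word_adjoint w) = w"
proof -
  have "letter_adjoint (letter_adjoint a) = a" for a :: "'g letter" by (cases a) auto
  then show ?thesis by (simp add: word_adjoint_def rev_map comp_def)
qed

lemma inj_word_adjoint: "inj word_adjoint"
  by (metis injI word_adjoint_word_adjoint)

lemma word_adjoint_add: "word_adjoint (v + w) = word_adjoint w + word_adjoint v"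
  by (simp add: word_adjoint_def plus_word_def)

definition free_star :: "('g word \<Rightarrow>\<^sub>0 complex) \<Rightarrow> 'g word \<Rightarrow>\<^sub>0 complex" where
  "free_star f = Poly_Mapping.map_key word_adjoint (Poly_Mapping.map cnj f)"

lemma lookup_free_star: "Poly_Mapping.lookup (free_star f) w = cnj (Poly_Mapping.lookup f (word_adjoint w))"
  unfolding free_star_def by (simp add: map_key.rep_eq[OF inj_word_adjoint] Poly_Mapping.map.rep_eq when_def)

lemma free_star_add: "free_star (f + g) = free_star f + free_star g"
  by (rule poly_mapping_eqI) (simp add: lookup_free_star lookup_add)

lemma free_star_single: "free_star (Poly_Mapping.single w c) = Poly_Mapping.single (word_adjoint w) (cnj c)"
proof (rule poly_mapping_eqI)
  fix v
  have "w = word_adjoint v \<longleftrightarrow> word_adjoint w = v" by (metis word_adjoint_word_adjoint)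
  then show "Poly_Mapping.lookup (free_star (Poly_Mapping.single w c)) v =
      Poly_Mapping.lookup (Poly_Mapping.single (word_adjoint w) (cnj c)) v"
    by (simp add: lookup_free_star lookup_single when_def)
qed

lemma poly_mapping_single_induct [case_names zero add]:
  fixes f :: "'k \<Rightarrow>\<^sub>0 'v::comm_monoid_add"
  assumes "P 0" "\<And>f a b. P f \<Longrightarrow> P (f + Poly_Mapping.single a b)"
  shows "P f"
proof (induction f rule: update_induct)
  case (update f a b)
  then have "Poly_Mapping.update a b f = f + Poly_Mapping.single a b"
    by (intro poly_mapping_eqI) (auto simp: lookup_update lookup_add lookup_single when_def in_keys_iff)
  then show ?case using assms(2) update by simp
qed (rule assms(1))

text \<open>Both sides are biadditive, so it suffices to compare them on words.\<close>

lemma free_star_mult: "free_star (f * g) = free_star g * free_star f"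
proof (induction f rule: poly_mapping_single_induct)
  case zero
  have "free_star 0 = (0 :: 'a word \<Rightarrow>\<^sub>0 complex)" by (rule poly_mapping_eqI) (simp add: lookup_free_star)
  then show ?case by simp
next
  case (add f a b)
  have "free_star (Poly_Mapping.single a b * g) = free_star g * free_star (Poly_Mapping.single a b)"
  proof (induction g rule: poly_mapping_single_induct)
    case zero
    have "free_star 0 = (0 :: 'a word \<Rightarrow>\<^sub>0 complex)" by (rule poly_mapping_eqI) (simp add: lookup_free_star)
    then show ?case by simp
  next
    case (add g c d)
    then show ?case
      by (simp add: distrib_left distrib_right free_star_add free_star_single mult_single
          word_adjoint_add mult.commute)
  qed
  then show ?case using add by (simp add: distrib_left distrib_right free_star_add)
qed

text \<open>Multiplication by a scalar is multiplication by a multiple of the empty word; this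
  centrality turns the axioms for scalars into ring identities.\<close>

lemma single_zero_commute:
  fixes f :: "'k::monoid_add \<Rightarrow>\<^sub>0 complex"
  shows "f * Poly_Mapping.single 0 c = Poly_Mapping.single 0 c * f"
  by (induction f rule: poly_mapping_single_induct)
    (simp_all add: distrib_left distrib_right mult_single mult.commute)

lemma keys_free_star: "w \<in> Poly_Mapping.keys (free_star f) \<longleftrightarrow> word_adjoint w \<in> Poly_Mapping.keys f"
  by (simp add: in_keys_iff lookup_free_star)

lemma word_adjoint_zero: "word_adjoint 0 = 0"
  by (simp add: word_adjoint_def zero_word_def)

lemma unital_star_algebra_free: "unital_star_algebra (free_star_algebra G)"
proof -
  let ?F = "free_star_algebra G"
  let ?L = "Gen ` G \<union> Adj ` G"
  have carrier: "f \<in> carrier ?F \<longleftrightarrow> (\<forall>w\<in>Poly_Mapping.keys f. set (letters w) \<subseteq> ?L)" for f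
    by (simp add: free_star_algebra_def)
  have ops: "mult ?F = (*)" "one ?F = 1" "zero ?F = 0" "add ?F = (+)"
    "smult ?F = (\<lambda>c x. Poly_Mapping.single 0 c * x)" "star ?F = free_star"
    by (simp_all add: free_star_algebra_def mult_map_scale_conv_mult free_star_def fun_eq_iff)
  have add: "f + g \<in> carrier ?F" if "f \<in> carrier ?F" "g \<in> carrier ?F" for f g
    using that keys_add[of f g] unfolding carrier by blast
  have mult: "f * g \<in> carrier ?F" if f: "f \<in> carrier ?F" and g: "g \<in> carrier ?F" for f g
    unfolding carrier
  proof
    fix w assume "w \<in> Poly_Mapping.keys (f * g)"
    then obtain a b where "w = a + b" "a \<in> Poly_Mapping.keys f" "b \<in> Poly_Mapping.keys g"
      using keys_mult[of f g] by blast
    then show "set (letters w) \<subseteq> ?L"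
      using f g unfolding carrier by (simp add: plus_word_def)
  qed
  have one: "1 \<in> carrier ?F" and zero: "0 \<in> carrier ?F"
    and scalar: "Poly_Mapping.single 0 c \<in> carrier ?F" for c
    unfolding carrier by (simp_all add: zero_word_def)
  have minus: "- f \<in> carrier ?F" if "f \<in> carrier ?F" for f
    using that unfolding carrier by (simp add: in_keys_iff)
  have star: "free_star f \<in> carrier ?F" if "f \<in> carrier ?F" for f
  proof -
    have "letter_adjoint ` ?L \<subseteq> ?L" by auto
    then have adj: "set (letters (word_adjoint w)) \<subseteq> ?L" if "set (letters w) \<subseteq> ?L" for w :: "'a word"
      using that unfolding word_adjoint_def by auto
    show ?thesis
      unfolding carrier
    proof (intro ballI)
      fix w assume "w \<in> Poly_Mapping.keys (free_star f)"
      then have "set (letters (word_adjoint w)) \<subseteq> ?L"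
        using that unfolding carrier keys_free_star by blast
      then show "set (letters w) \<subseteq> ?L" using adj[of "word_adjoint w"] by simp
    qed
  qed
  have "ring ?F"
  proof (intro ringI abelian_groupI monoidI)
    show "\<exists>y\<in>carrier ?F. y \<oplus>\<^bsub>?F\<^esub> x = \<zero>\<^bsub>?F\<^esub>" if "x \<in> carrier ?F" for x
      using minus[OF that] by (intro bexI[of _ "- x"]) (simp_all add: ops)
  qed (simp_all add: ops add mult one zero add_ac mult.assoc distrib_left distrib_right)
  then show ?thesis
  proof (intro unital_star_algebra.intro unital_star_algebra_axioms.intro)
    show "x \<otimes>\<^bsub>?F\<^esub> (c \<odot>\<^bsub>?F\<^esub> y) = c \<odot>\<^bsub>?F\<^esub> (x \<otimes>\<^bsub>?F\<^esub> y)" for x y c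
      unfolding ops by (simp only: mult.assoc[symmetric] single_zero_commute)
    show "star ?F (star ?F x) = x" for x
      unfolding ops by (rule poly_mapping_eqI) (simp add: lookup_free_star)
    show "star ?F (c \<odot>\<^bsub>?F\<^esub> x) = cnj c \<odot>\<^bsub>?F\<^esub> star ?F x" for x c
      unfolding ops by (simp only: free_star_mult free_star_single word_adjoint_zero single_zero_commute)
    show "c \<odot>\<^bsub>?F\<^esub> (d \<odot>\<^bsub>?F\<^esub> x) = (c * d) \<odot>\<^bsub>?F\<^esub> x" for x c d
      unfolding ops by (simp add: mult.assoc[symmetric] mult_single)
  qed (simp_all add: ops add mult scalar star free_star_add free_star_mult distrib_left distrib_right
      mult.assoc single_add)
qed

lemma free_gen_closed: "g \<in> G \<Longrightarrow> free_gen g \<in> carrier (free_star_algebra G)"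
  by (simp add: free_gen_def free_star_algebra_def)

section \<open>Quotients by star-ideals\<close>

text \<open>Transfers the ring axioms between records that differ in their further fields only; no
  equation between the records themselves can be stated, as their types differ.\<close>

lemma ring_cong:
  assumes "ring R" "carrier S = carrier R" "mult S = mult R" "one S = one R" "zero S = zero R" "add S = add R"
  shows "ring S"
proof -
  interpret R: ring R by fact
  show ?thesis
  proof (intro ringI abelian_groupI monoidI)
    show "\<exists>y\<in>carrier S. y \<oplus>\<^bsub>S\<^esub> x = \<zero>\<^bsub>S\<^esub>" if "x \<in> carrier S" for x
      using that by (intro bexI[of _ "\<ominus>\<^bsub>R\<^esub> x"]) (simp_all add: assms(2-) R.l_neg)
  qed (simp_all add: assms(2-) R.a_ac R.m_assoc R.l_distr R.r_distr)
qed

context unital_star_algebra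
begin

lemma ideal_smult_closed:
  assumes "ideal J A" "x \<in> J"
  shows "c \<odot> x \<in> J"
proof -
  interpret J: ideal J A by fact
  have "(c \<odot> \<one>) \<otimes> x \<in> J" using assms(2) by (intro J.I_l_closed) auto
  then show ?thesis using J.Icarr[OF assms(2)] by (simp add: mult_smult_left)
qed

text \<open>The elements whose star lies in the ideal form an ideal themselves, because the star is an
  antiautomorphism; it contains the generators, hence the whole ideal.\<close>

lemma star_ideal_generated_is_star_ideal:
  assumes S: "S \<subseteq> carrier A"
  shows "ideal (star_ideal_generated A S) A"
    and "S \<subseteq> star_ideal_generated A S"
    and "star A ` star_ideal_generated A S \<subseteq> star_ideal_generated A S"
proof -
  let ?J = "star_ideal_generated A S"
  have gen: "S \<union> star A ` S \<subseteq> carrier A" using S by auto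
  show ideal: "ideal ?J A"
    unfolding star_ideal_generated_def by (rule genideal_ideal[OF gen])
  show "S \<subseteq> ?J"
    using genideal_self[OF gen] unfolding star_ideal_generated_def by blast
  interpret J: ideal ?J A by (rule ideal)
  let ?K = "{x \<in> carrier A. star A x \<in> ?J}"
  have "ideal ?K A"
  proof (rule idealI)
    show "ring A" by (rule ring_axioms)
    show "subgroup ?K (add_monoid A)"
    proof (rule add.subgroupI)
      show "\<ominus> a \<in> ?K" if "a \<in> ?K" for a
        using that by (simp add: star_minus)
    qed (auto simp: star_add intro!: exI[of _ \<zero>])
  qed (auto simp: star_mult J.I_l_closed J.I_r_closed)
  moreover have "S \<union> star A ` S \<subseteq> ?K"
    using genideal_self[OF gen] S unfolding star_ideal_generated_def by (auto simp: subset_iff)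
  ultimately have "?J \<subseteq> ?K"
    unfolding star_ideal_generated_def by (rule genideal_minimal)
  then show "star A ` ?J \<subseteq> ?J" by blast
qed

text \<open>All operations on cosets are computed on representatives, so every axiom is inherited.\<close>

lemma unital_star_algebra_quotient:
  assumes ideal: "ideal J A" and star_subset: "star A ` J \<subseteq> J"
  shows "unital_star_algebra (quotient_star_algebra A J)" (is "unital_star_algebra ?Q")
    and "x \<in> carrier A \<Longrightarrow> J +> x \<in> carrier (quotient_star_algebra A J)"
    and "x \<in> carrier A \<Longrightarrow> star (quotient_star_algebra A J) (J +> x) = J +> star A x"
proof -
  interpret J: ideal J A by fact
  have star: "star A x \<in> J" if "x \<in> J" for x using star_subset that by blast
  have carrier: "carrier ?Q = (+>) J ` carrier A"
    by (auto simp: quotient_star_algebra_def ring.extend_def FactRing_simps)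
  then show closed: "x \<in> carrier A \<Longrightarrow> J +> x \<in> carrier ?Q" for x by blast
  have add: "(J +> x) \<oplus>\<^bsub>?Q\<^esub> (J +> y) = J +> (x \<oplus> y)"
    and mult: "(J +> x) \<otimes>\<^bsub>?Q\<^esub> (J +> y) = J +> (x \<otimes> y)" if "x \<in> carrier A" "y \<in> carrier A" for x y
    using that by (simp_all add: quotient_star_algebra_def ring.extend_def FactRing_def
        J.a_rcos_sum J.rcoset_mult_add)
  have coset: "y \<in> J +> x \<longleftrightarrow> (\<exists>h\<in>J. y = h \<oplus> x)" for x y
    by (auto simp: a_r_coset_def')
  \<comment> \<open>For c = 0 the image of the coset is only the zero element; adding J makes it a coset again.\<close>
  have smult: "c \<odot>\<^bsub>?Q\<^esub> (J +> x) = J +> (c \<odot> x)" if x: "x \<in> carrier A" for c x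
  proof -
    have "set_add A J ((\<odot>) c ` (J +> x)) = J +> (c \<odot> x)"
    proof (intro Set.set_eqI iffI)
      fix y assume "y \<in> set_add A J ((\<odot>) c ` (J +> x))"
      then obtain h h' where h: "h \<in> J" "h' \<in> J" "y = h \<oplus> c \<odot> (h' \<oplus> x)"
        by (auto simp: set_add_def' coset)
      then have "y = (h \<oplus> c \<odot> h') \<oplus> c \<odot> x"
        using x J.Icarr by (simp add: smult_add_right a_assoc)
      moreover have "h \<oplus> c \<odot> h' \<in> J" using h ideal_smult_closed[OF ideal] by simp
      ultimately show "y \<in> J +> (c \<odot> x)" unfolding coset by blast
    next
      fix y assume "y \<in> J +> (c \<odot> x)"
      then obtain h where "h \<in> J" "y = h \<oplus> c \<odot> x" unfolding coset by blast
      moreover have "x \<in> J +> x" using x by (rule J.a_rcos_self)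
      ultimately show "y \<in> set_add A J ((\<odot>) c ` (J +> x))" by (auto simp: set_add_def')
    qed
    then show ?thesis by (simp add: quotient_star_algebra_def ring.extend_def FactRing_def)
  qed
  show star_coset: "star ?Q (J +> x) = J +> star A x" if x: "x \<in> carrier A" for x
  proof -
    have "star A ` (J +> x) = J +> star A x"
    proof (intro Set.set_eqI iffI)
      fix y assume "y \<in> star A ` (J +> x)"
      then obtain h where "h \<in> J" "y = star A (h \<oplus> x)" by (auto simp: coset)
      then show "y \<in> J +> star A x"
        using x J.Icarr star unfolding coset by (auto simp: star_add)
    next
      fix y assume "y \<in> J +> star A x"
      then obtain h where h: "h \<in> J" "y = h \<oplus> star A x" unfolding coset by blast
      then have "y = star A (star A h \<oplus> x)" using x J.Icarr by (simp add: star_add)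
      moreover have "star A h \<oplus> x \<in> J +> x" using h star unfolding coset by blast
      ultimately show "y \<in> star A ` (J +> x)" by blast
    qed
    then show ?thesis by (simp add: quotient_star_algebra_def ring.extend_def FactRing_def)
  qed
  have one: "\<one>\<^bsub>?Q\<^esub> = J +> \<one>"
    by (simp add: quotient_star_algebra_def ring.extend_def FactRing_def)
  have "ring ?Q"
    by (rule ring_cong[OF J.quotient_is_ring])
      (simp_all add: quotient_star_algebra_def ring.extend_def FactRing_def)
  then show "unital_star_algebra ?Q"
    by (intro unital_star_algebra.intro unital_star_algebra_axioms.intro)
      (auto simp: carrier add mult smult star_coset smult_add_left smult_add_right smult_smult
        mult_smult_left mult_smult_right star_add star_mult star_smult)
qed

end

section \<open>Completion with respect to a C*-seminorm\<close>

locale seminormed_star_algebra = unital_star_algebra A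
  for A :: "('a, 'b) star_algebra_scheme" (structure) +
  fixes N :: "'a \<Rightarrow> real"
  assumes seminorm: "cstar_seminorm A N"
begin

lemma N_nonneg: "x \<in> carrier A \<Longrightarrow> 0 \<le> N x"
  and N_smult: "x \<in> carrier A \<Longrightarrow> N (c \<odot> x) = cmod c * N x"
  and N_add: "\<lbrakk>x \<in> carrier A; y \<in> carrier A\<rbrakk> \<Longrightarrow> N (x \<oplus> y) \<le> N x + N y"
  and N_mult: "\<lbrakk>x \<in> carrier A; y \<in> carrier A\<rbrakk> \<Longrightarrow> N (x \<otimes> y) \<le> N x * N y"
  and N_star_mult: "x \<in> carrier A \<Longrightarrow> N (star A x \<otimes> x) = (N x)\<^sup>2"
  using seminorm by (simp_all add: cstar_seminorm_def)

lemma N_zero: "N \<zero> = 0"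
  using N_smult[of \<zero> 0] by simp

text \<open>Cancel \<open>N x\<close> in \<open>(N x)\<^sup>2 = N (x\<^sup>* x) \<le> N (x\<^sup>*) N x\<close>.\<close>

lemma N_star_le: "x \<in> carrier A \<Longrightarrow> N x \<le> N (star A x)"
proof (cases "N x = 0")
  case False
  assume x: "x \<in> carrier A"
  then have "N x * N x \<le> N (star A x) * N x"
    using N_mult[of "star A x" x] N_star_mult[of x] by (simp add: power2_eq_square)
  moreover have "0 < N x" using False N_nonneg[OF x] by simp
  ultimately show ?thesis by simp
qed (simp add: N_nonneg)

lemma N_star: "x \<in> carrier A \<Longrightarrow> N (star A x) = N x"
  using N_star_le[of x] N_star_le[of "star A x"] by simp

abbreviation C :: "(nat \<Rightarrow> 'a) star_algebra" where
  "C \<equiv> cauchy_star_algebra A N"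

lemma cauchy_iff: "x \<in> carrier C \<longleftrightarrow>
    (\<forall>i. x i \<in> carrier A) \<and> (\<forall>e>0. \<exists>M. \<forall>i\<ge>M. \<forall>j\<ge>M. N (x i \<ominus> x j) < e)"
  by (simp add: cauchy_star_algebra_def)

lemma cauchy_ops: "mult C = (\<lambda>x y i. x i \<otimes> y i)" "one C = (\<lambda>i. \<one>)" "zero C = (\<lambda>i. \<zero>)"
  "add C = (\<lambda>x y i. x i \<oplus> y i)" "smult C = (\<lambda>c x i. c \<odot> x i)" "star C = (\<lambda>x i. star A (x i))"
  by (simp_all add: cauchy_star_algebra_def)

lemma cauchy_closed: "x \<in> carrier C \<Longrightarrow> x i \<in> carrier A"
  by (simp add: cauchy_iff)

lemma cauchy_const: "a \<in> carrier A \<Longrightarrow> (\<lambda>i. a) \<in> carrier C"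
  by (simp add: cauchy_iff a_minus_def r_neg N_zero)

lemma cauchy_bounded:
  assumes x: "x \<in> carrier C"
  obtains B where "B > 0" "\<And>i. N (x i) \<le> B"
proof -
  obtain M where M: "N (x i \<ominus> x M) < 1" if "i \<ge> M" for i
    using x unfolding cauchy_iff by (metis order_refl zero_less_one)
  define B where "B = 1 + (\<Sum>i\<le>M. N (x i))"
  note c = cauchy_closed[OF x]
  have nonneg: "N (x i) \<ge> 0" for i using c by (simp add: N_nonneg)
  have le: "N (x i) \<le> (\<Sum>i\<le>M. N (x i))" if "i \<le> M" for i
    using that by (intro member_le_sum) (auto simp: nonneg)
  have "N (x i) \<le> B" for i
  proof (cases "i \<le> M")
    case True
    then show ?thesis using le by (simp add: B_def add_increasing)
  next
    case False
    have "x i = (x i \<ominus> x M) \<oplus> x M" using c by (simp add: a_minus_def a_assoc l_neg)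
    then have "N (x i) \<le> N (x i \<ominus> x M) + N (x M)"
      using N_add[of "x i \<ominus> x M" "x M"] c by simp
    then show ?thesis using M[of i] le[of M] False by (simp add: B_def)
  qed
  moreover have "B > 0" using nonneg unfolding B_def by (simp add: add_pos_nonneg sum_nonneg)
  ultimately show ?thesis using that by blast
qed

text \<open>The common shape of the estimates for sums, products and stars of Cauchy sequences.\<close>

lemma cauchyI:
  assumes "\<And>i. z i \<in> carrier A" and x: "x \<in> carrier C" and y: "y \<in> carrier C" and K: "K > 0"
    and le: "\<And>i j. N (z i \<ominus> z j) \<le> K * (N (x i \<ominus> x j) + N (y i \<ominus> y j))"
  shows "z \<in> carrier C"
  unfolding cauchy_iff
proof (intro conjI allI impI)
  fix e :: real assume "e > 0"
  then have e: "e / (2 * K) > 0" using K by simp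
  obtain M1 where M1: "\<And>i j. i \<ge> M1 \<Longrightarrow> j \<ge> M1 \<Longrightarrow> N (x i \<ominus> x j) < e / (2 * K)"
    using x e unfolding cauchy_iff by blast
  obtain M2 where M2: "\<And>i j. i \<ge> M2 \<Longrightarrow> j \<ge> M2 \<Longrightarrow> N (y i \<ominus> y j) < e / (2 * K)"
    using y e unfolding cauchy_iff by blast
  show "\<exists>M. \<forall>i\<ge>M. \<forall>j\<ge>M. N (z i \<ominus> z j) < e"
  proof (intro exI[of _ "max M1 M2"] allI impI)
    fix i j assume "i \<ge> max M1 M2" "j \<ge> max M1 M2"
    then have "N (x i \<ominus> x j) + N (y i \<ominus> y j) < e / K"
      using M1[of i j] M2[of i j] by (simp add: field_simps)
    then have "K * (N (x i \<ominus> x j) + N (y i \<ominus> y j)) < e"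
      using K by (simp add: field_simps)
    then show "N (z i \<ominus> z j) < e" using le[of i j] by simp
  qed
qed (rule assms(1))

lemma cauchy_add:
  assumes x: "x \<in> carrier C" and y: "y \<in> carrier C"
  shows "(\<lambda>i. x i \<oplus> y i) \<in> carrier C"
proof (rule cauchyI[OF _ x y zero_less_one])
  note c = cauchy_closed[OF x] cauchy_closed[OF y]
  show "x i \<oplus> y i \<in> carrier A" for i using c by simp
  fix i j
  have "(x i \<oplus> y i) \<ominus> (x j \<oplus> y j) = (x i \<ominus> x j) \<oplus> (y i \<ominus> y j)"
    using c by (simp add: a_minus_def minus_add a_ac)
  then show "N ((x i \<oplus> y i) \<ominus> (x j \<oplus> y j)) \<le> 1 * (N (x i \<ominus> x j) + N (y i \<ominus> y j))"
    using c N_add by simp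
qed

text \<open>With \<open>dx = x\<^sub>i - x\<^sub>j\<close> and \<open>dy = y\<^sub>i - y\<^sub>j\<close>, the difference of the products is
  \<open>x\<^sub>i dy + dx y\<^sub>j\<close>, and Cauchy sequences are bounded.\<close>

lemma cauchy_mult:
  assumes x: "x \<in> carrier C" and y: "y \<in> carrier C"
  shows "(\<lambda>i. x i \<otimes> y i) \<in> carrier C"
proof -
  obtain B1 B2 where B1: "B1 > 0" "\<And>i. N (x i) \<le> B1" and B2: "B2 > 0" "\<And>i. N (y i) \<le> B2"
    using cauchy_bounded[OF x] cauchy_bounded[OF y] by metis
  note c = cauchy_closed[OF x] cauchy_closed[OF y]
  show ?thesis
  proof (rule cauchyI[OF _ x y])
    show "B1 + B2 > 0" using B1 B2 by simp
    show "x i \<otimes> y i \<in> carrier A" for i using c by simp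
    fix i j
    let ?dx = "x i \<ominus> x j" and ?dy = "y i \<ominus> y j"
    have nn: "0 \<le> N ?dx" "0 \<le> N ?dy" using c by (simp_all add: N_nonneg)
    have "(x i \<otimes> y i) \<ominus> (x j \<otimes> y j) = (x i \<otimes> ?dy) \<oplus> (?dx \<otimes> y j)"
    proof -
      have "(x i \<otimes> ?dy) \<oplus> (?dx \<otimes> y j) =
          x i \<otimes> y i \<oplus> (\<ominus> (x i \<otimes> y j) \<oplus> x i \<otimes> y j) \<oplus> \<ominus> (x j \<otimes> y j)"
        using c by (simp add: a_minus_def l_distr r_distr l_minus r_minus a_assoc)
      then show ?thesis using c by (simp add: a_minus_def l_neg)
    qed
    then have "N ((x i \<otimes> y i) \<ominus> (x j \<otimes> y j)) \<le> N (x i \<otimes> ?dy) + N (?dx \<otimes> y j)"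
      using c N_add by simp
    also have "\<dots> \<le> N (x i) * N ?dy + N ?dx * N (y j)"
      using c by (intro add_mono N_mult) auto
    also have "\<dots> \<le> B1 * N ?dy + N ?dx * B2"
      using nn B1 B2 by (intro add_mono mult_mono) (auto simp: N_nonneg c)
    also have "\<dots> \<le> (B1 + B2) * (N ?dx + N ?dy)"
      using nn B1 B2 by (simp add: algebra_simps)
    finally show "N ((x i \<otimes> y i) \<ominus> (x j \<otimes> y j)) \<le> (B1 + B2) * (N ?dx + N ?dy)" .
  qed
qed

lemma cauchy_smult:
  assumes x: "x \<in> carrier C"
  shows "(\<lambda>i. c \<odot> x i) \<in> carrier C"
  using cauchy_mult[OF cauchy_const[of "c \<odot> \<one>"] x] cauchy_closed[OF x]
  by (simp add: mult_smult_left)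

lemma cauchy_star:
  assumes x: "x \<in> carrier C"
  shows "(\<lambda>i. star A (x i)) \<in> carrier C"
proof (rule cauchyI[OF _ x x zero_less_one])
  note c = cauchy_closed[OF x]
  show "star A (x i) \<in> carrier A" for i using c by simp
  fix i j
  have "star A (x i) \<ominus> star A (x j) = star A (x i \<ominus> x j)"
    using c by (simp add: a_minus_def star_add star_minus)
  then show "N (star A (x i) \<ominus> star A (x j)) \<le> 1 * (N (x i \<ominus> x j) + N (x i \<ominus> x j))"
    using c by (simp add: N_star N_nonneg)
qed

lemma unital_star_algebra_cauchy: "unital_star_algebra C"
proof -
  have "ring C"
  proof (intro ringI abelian_groupI monoidI)
    fix x assume x: "x \<in> carrier C"
    note c = cauchy_closed[OF x]
    have "(\<lambda>i. \<ominus> x i) \<in> carrier C"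
      using cauchy_smult[OF x, of "-1"] c by (simp add: smult_minus_one)
    then show "\<exists>y\<in>carrier C. y \<oplus>\<^bsub>C\<^esub> x = \<zero>\<^bsub>C\<^esub>"
      using c by (intro bexI[of _ "\<lambda>i. \<ominus> x i"]) (simp_all add: cauchy_ops l_neg)
  qed (simp_all add: cauchy_ops cauchy_add cauchy_mult cauchy_const cauchy_closed fun_eq_iff
      a_ac m_assoc l_distr r_distr)
  then show ?thesis
    by (intro unital_star_algebra.intro unital_star_algebra_axioms.intro)
      (simp_all add: cauchy_ops cauchy_add cauchy_mult cauchy_smult cauchy_star cauchy_closed fun_eq_iff
        smult_add_left smult_add_right smult_smult mult_smult_left mult_smult_right
        star_add star_mult star_smult)
qed

abbreviation Null :: "(nat \<Rightarrow> 'a) set" where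
  "Null \<equiv> null_sequences A N"

lemma null_iff: "x \<in> Null \<longleftrightarrow> x \<in> carrier C \<and> (\<lambda>i. N (x i)) \<longlonglongrightarrow> 0"
  by (simp add: null_sequences_def)

lemma nullI:
  assumes "z \<in> carrier C" "\<And>i. N (z i) \<le> f i" "f \<longlonglongrightarrow> 0"
  shows "z \<in> Null"
proof -
  have "(\<lambda>i. N (z i)) \<longlonglongrightarrow> 0"
    by (rule tendsto_sandwich[OF _ _ tendsto_const assms(3)])
      (use assms cauchy_closed N_nonneg in auto)
  then show ?thesis using assms(1) by (simp add: null_iff)
qed

text \<open>A null sequence stays null when multiplied by a bounded sequence on either side.\<close>

lemma ideal_null: "ideal Null C"
proof -
  interpret C: unital_star_algebra C by (rule unital_star_algebra_cauchy)
  have mult_left: "y \<otimes>\<^bsub>C\<^esub> x \<in> Null" if x: "x \<in> Null" and y: "y \<in> carrier C" for x y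
  proof -
    obtain B where B: "B > 0" "\<And>i. N (y i) \<le> B" using cauchy_bounded[OF y] by blast
    have xC: "x \<in> carrier C" using x by (simp add: null_iff)
    have "N (y i \<otimes> x i) \<le> B * N (x i)" for i
    proof -
      have "N (y i \<otimes> x i) \<le> N (y i) * N (x i)"
        using xC y by (intro N_mult) (auto simp: cauchy_closed)
      also have "\<dots> \<le> B * N (x i)"
        using B xC by (intro mult_right_mono) (auto simp: N_nonneg cauchy_closed)
      finally show ?thesis .
    qed
    moreover have "(\<lambda>i. B * N (x i)) \<longlonglongrightarrow> 0"
      using x by (intro tendsto_mult_right_zero) (simp add: null_iff)
    ultimately show ?thesis
      using cauchy_mult[OF y xC] unfolding cauchy_ops by (intro nullI)
  qed
  have mult_right: "x \<otimes>\<^bsub>C\<^esub> y \<in> Null" if x: "x \<in> Null" and y: "y \<in> carrier C" for x y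
  proof -
    obtain B where B: "B > 0" "\<And>i. N (y i) \<le> B" using cauchy_bounded[OF y] by blast
    have xC: "x \<in> carrier C" using x by (simp add: null_iff)
    have "N (x i \<otimes> y i) \<le> N (x i) * B" for i
    proof -
      have "N (x i \<otimes> y i) \<le> N (x i) * N (y i)"
        using xC y by (intro N_mult) (auto simp: cauchy_closed)
      also have "\<dots> \<le> N (x i) * B"
        using B xC by (intro mult_left_mono) (auto simp: N_nonneg cauchy_closed)
      finally show ?thesis .
    qed
    moreover have "(\<lambda>i. N (x i) * B) \<longlonglongrightarrow> 0"
      using x by (intro tendsto_mult_left_zero) (simp add: null_iff)
    ultimately show ?thesis
      using cauchy_mult[OF xC y] unfolding cauchy_ops by (intro nullI)
  qed
  show ?thesis
  proof (rule idealI)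
    show "ring C" by (rule C.ring_axioms)
    show "subgroup Null (add_monoid C)"
    proof (rule C.add.subgroupI)
      show "Null \<subseteq> carrier C" by (auto simp: null_iff)
      have "\<zero>\<^bsub>C\<^esub> \<in> Null"
        unfolding null_iff by (simp add: cauchy_ops N_zero cauchy_const)
      then show "Null \<noteq> {}" by blast
      show "\<ominus>\<^bsub>C\<^esub> x \<in> Null" if x: "x \<in> Null" for x
      proof -
        have "(\<ominus>\<^bsub>C\<^esub> \<one>\<^bsub>C\<^esub>) \<otimes>\<^bsub>C\<^esub> x \<in> Null" using x by (intro mult_left) auto
        then show ?thesis using x by (simp add: null_iff C.l_minus)
      qed
      show "x \<oplus>\<^bsub>C\<^esub> y \<in> Null" if "x \<in> Null" "y \<in> Null" for x y
        unfolding cauchy_ops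
      proof (rule nullI)
        show "(\<lambda>i. x i \<oplus> y i) \<in> carrier C" using that by (simp add: null_iff cauchy_add)
        show "N (x i \<oplus> y i) \<le> N (x i) + N (y i)" for i
          using that by (intro N_add) (auto simp: null_iff cauchy_closed)
        show "(\<lambda>i. N (x i) + N (y i)) \<longlonglongrightarrow> 0"
          using that tendsto_add[of "\<lambda>i. N (x i)" 0 sequentially "\<lambda>i. N (y i)" 0] by (simp add: null_iff)
      qed
    qed
  qed (use mult_left mult_right in auto)
qed

lemma null_star: "star C ` Null \<subseteq> Null"
  by (auto simp: null_iff cauchy_ops cauchy_star N_star cauchy_closed)

lemma unital_star_algebra_completion:
  shows "unital_star_algebra (completion A N)"
    and "a \<in> carrier A \<Longrightarrow> completion_embed A N a \<in> carrier (completion A N)"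
    and "a \<in> carrier A \<Longrightarrow> star (completion A N) (completion_embed A N a) = completion_embed A N (star A a)"
proof -
  interpret C: unital_star_algebra C by (rule unital_star_algebra_cauchy)
  let ?Q = "quotient_star_algebra C Null" and ?D = "completion A N"
  note quotient = C.unital_star_algebra_quotient[OF ideal_null null_star]
  interpret Q: unital_star_algebra ?Q by (rule quotient(1))
  have ops: "carrier ?D = carrier ?Q" "mult ?D = mult ?Q" "one ?D = one ?Q" "zero ?D = zero ?Q"
    "add ?D = add ?Q" "smult ?D = smult ?Q" "star ?D = star ?Q"
    by (simp_all add: completion_def star_algebra.extend_def)
  have "ring ?D" by (rule ring_cong[OF Q.ring_axioms]) (simp_all add: ops)
  then show "unital_star_algebra ?D"
    by (intro unital_star_algebra.intro unital_star_algebra_axioms.intro)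
      (simp_all add: ops Q.smult_add_left Q.smult_add_right Q.smult_smult Q.mult_smult_left
        Q.mult_smult_right Q.star_add Q.star_mult Q.star_smult)
  show "a \<in> carrier A \<Longrightarrow> completion_embed A N a \<in> carrier ?D"
    unfolding ops completion_embed_def by (intro quotient(2) cauchy_const)
  show "a \<in> carrier A \<Longrightarrow> star ?D (completion_embed A N a) = completion_embed A N (star A a)"
    unfolding ops completion_embed_def by (subst quotient(3)) (simp_all add: cauchy_const cauchy_ops)
qed

end

text \<open>Each condition on seminorms passes to pointwise suprema. The supremum is over a nonempty
  set because the zero function is a C*-seminorm, and over a bounded one by assumption.\<close>

lemma (in unital_star_algebra) cstar_seminorm_max:
  assumes bounded: "cstar_seminorms_bounded A"
  shows "cstar_seminorm A (max_cstar_seminorm A)"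
proof -
  let ?M = "max_cstar_seminorm A"
  let ?S = "\<lambda>x. {N x | N. cstar_seminorm A N}"
  have nonempty: "?S x \<noteq> {}" for x
  proof -
    have "cstar_seminorm A (\<lambda>x. 0)" by (simp add: cstar_seminorm_def)
    then show ?thesis by blast
  qed
  have upper: "N x \<le> ?M x" if "cstar_seminorm A N" "x \<in> carrier A" for N x
    unfolding max_cstar_seminorm_def using bounded that
    by (intro cSup_upper) (auto simp: cstar_seminorms_bounded_def)
  have least: "?M x \<le> c" if "\<And>N. cstar_seminorm A N \<Longrightarrow> N x \<le> c" for x c
    unfolding max_cstar_seminorm_def using nonempty that by (intro cSup_least) auto
  have nonneg: "0 \<le> ?M x" if "x \<in> carrier A" for x
    using upper[of "\<lambda>x. 0" x] that by (simp add: cstar_seminorm_def)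
  have smult_le: "?M (c \<odot> x) \<le> cmod c * ?M x" if x: "x \<in> carrier A" for c x
  proof (rule least)
    fix N assume N: "cstar_seminorm A N"
    then have "N (c \<odot> x) = cmod c * N x" using x by (simp add: cstar_seminorm_def)
    also have "\<dots> \<le> cmod c * ?M x" using upper[OF N x] by (simp add: mult_left_mono)
    finally show "N (c \<odot> x) \<le> cmod c * ?M x" .
  qed
  have smult: "?M (c \<odot> x) = cmod c * ?M x" if x: "x \<in> carrier A" for c x
  proof (cases "c = 0")
    case True
    then show ?thesis using smult_le[OF x, of 0] nonneg[of \<zero>] x by simp
  next
    case False
    have "?M ((1 / c) \<odot> (c \<odot> x)) \<le> cmod (1 / c) * ?M (c \<odot> x)"
      using x by (intro smult_le) simp
    then have "cmod c * ?M x \<le> ?M (c \<odot> x)"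
      using x False by (simp add: smult_smult norm_divide field_simps)
    then show ?thesis using smult_le[OF x] by (intro antisym)
  qed
  have add: "?M (x \<oplus> y) \<le> ?M x + ?M y" if x: "x \<in> carrier A" and y: "y \<in> carrier A" for x y
  proof (rule least)
    fix N assume N: "cstar_seminorm A N"
    then have "N (x \<oplus> y) \<le> N x + N y" using x y by (simp add: cstar_seminorm_def)
    also have "\<dots> \<le> ?M x + ?M y" using upper[OF N] x y by (intro add_mono)
    finally show "N (x \<oplus> y) \<le> ?M x + ?M y" .
  qed
  have mult: "?M (x \<otimes> y) \<le> ?M x * ?M y" if x: "x \<in> carrier A" and y: "y \<in> carrier A" for x y
  proof (rule least)
    fix N assume N: "cstar_seminorm A N"
    then have "N (x \<otimes> y) \<le> N x * N y" using x y by (simp add: cstar_seminorm_def)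
    also have "\<dots> \<le> ?M x * ?M y"
      using upper[OF N] x y nonneg N by (intro mult_mono) (auto simp: cstar_seminorm_def)
    finally show "N (x \<otimes> y) \<le> ?M x * ?M y" .
  qed
  have star: "?M (star A x \<otimes> x) = (?M x)\<^sup>2" if x: "x \<in> carrier A" for x
  proof (rule antisym)
    show "?M (star A x \<otimes> x) \<le> (?M x)\<^sup>2"
    proof (rule least)
      fix N assume N: "cstar_seminorm A N"
      then have "N (star A x \<otimes> x) = (N x)\<^sup>2" using x by (simp add: cstar_seminorm_def)
      also have "\<dots> \<le> (?M x)\<^sup>2"
        using upper[OF N x] x N by (intro power_mono) (auto simp: cstar_seminorm_def)
      finally show "N (star A x \<otimes> x) \<le> (?M x)\<^sup>2" .
    qed
    \<comment> \<open>Squares are compared through square roots, so that the supremum is bounded before squaring.\<close>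
    have "?M x \<le> sqrt (?M (star A x \<otimes> x))"
    proof (rule least)
      fix N assume N: "cstar_seminorm A N"
      then have "(N x)\<^sup>2 \<le> ?M (star A x \<otimes> x)"
        using upper[OF N, of "star A x \<otimes> x"] x by (simp add: cstar_seminorm_def)
      then show "N x \<le> sqrt (?M (star A x \<otimes> x))" by (rule real_le_rsqrt)
    qed
    then have "(?M x)\<^sup>2 \<le> (sqrt (?M (star A x \<otimes> x)))\<^sup>2"
      using nonneg[OF x] by (intro power_mono)
    then show "(?M x)\<^sup>2 \<le> ?M (star A x \<otimes> x)" using nonneg[of "star A x \<otimes> x"] x by simp
  qed
  show ?thesis
    unfolding cstar_seminorm_def by (intro conjI ballI allI nonneg smult add mult star)
qed

section \<open>The generators of the partition algebra\<close>

lemma free_gen_in_free_alg: "i \<in> {1..n} \<Longrightarrow> j \<in> {1..n} \<Longrightarrow> free_u i j \<in> carrier (free_alg n)"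
  by (intro free_gen_closed) simp

lemma free_star_algebra_minus:
  assumes "x \<in> carrier (free_star_algebra G)" "y \<in> carrier (free_star_algebra G)"
  shows "x \<ominus>\<^bsub>free_star_algebra G\<^esub> y = x - y"
proof -
  interpret F: unital_star_algebra "free_star_algebra G" by (rule unital_star_algebra_free)
  have "x = (x \<ominus>\<^bsub>free_star_algebra G\<^esub> y) \<oplus>\<^bsub>free_star_algebra G\<^esub> y"
    using assms by (simp add: a_minus_def F.a_assoc F.l_neg)
  also have "\<dots> = (x \<ominus>\<^bsub>free_star_algebra G\<^esub> y) + y"
    by (simp add: free_star_algebra_def)
  finally show ?thesis by (rule eq_diff_eq[THEN iffD2, OF sym])
qed

text \<open>The ideal generated by a set is the intersection of the ideals that contain it; it is an
  ideal only if some ideal contains the set, that is, if the set lies in the carrier.\<close>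

lemma relators_closed: "relators n X \<subseteq> carrier (free_alg n)"
proof -
  interpret F: unital_star_algebra "free_alg n" by (rule unital_star_algebra_free)
  have diff: "x - y \<in> carrier (free_alg n)" if "x \<in> carrier (free_alg n)" "y \<in> carrier (free_alg n)" for x y
    unfolding free_star_algebra_minus[OF that, symmetric] by (rule F.minus_closed[OF that])
  have monomial: "monomial (free_alg n) free_u \<gamma> \<alpha> \<in> carrier (free_alg n)"
    if "\<gamma> \<in> multi_indices n k" "\<alpha> \<in> multi_indices n k" for \<gamma> \<alpha> k
    by (rule F.monomial_closed[OF free_gen_in_free_alg that])
  have lhs: "rel_lhs (free_alg n) n free_u k p \<alpha> \<beta> \<in> carrier (free_alg n)"
    if "\<alpha> \<in> multi_indices n k" for k p \<alpha> \<beta>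
    unfolding rel_lhs_def by (intro F.finsum_closed Pi_I F.smult_closed monomial[OF _ that])
  have rhs: "rel_rhs (free_alg n) n free_u l p \<alpha> \<beta> \<in> carrier (free_alg n)"
    if "\<beta> \<in> multi_indices n l" for l p \<alpha> \<beta>
    unfolding rel_rhs_def by (intro F.finsum_closed Pi_I F.smult_closed monomial[OF that])
  have "free_u i j - star (free_alg n) (free_u i j) \<in> carrier (free_alg n)"
    if "i \<in> {1..n}" "j \<in> {1..n}" for i j
    by (intro diff F.star_closed free_gen_in_free_alg that)
  moreover have "rel_lhs (free_alg n) n free_u k p \<alpha> \<beta> - rel_rhs (free_alg n) n free_u l p \<alpha> \<beta>
      \<in> carrier (free_alg n)"
    if "\<alpha> \<in> multi_indices n k" "\<beta> \<in> multi_indices n l" for k l p \<alpha> \<beta>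
    by (intro diff lhs rhs that)
  ultimately show ?thesis
    unfolding relators_def by blast
qed

text \<open>The closure properties rest on this alone: the partition algebra is a unital star-algebra,
  as the completion of a quotient of the free one, and its generators are self-adjoint, by the
  relators \<open>u\<^sub>i\<^sub>j - u\<^sub>i\<^sub>j\<^sup>*\<close>. By admissibility the supremum of all C*-seminorms is itself a
  C*-seminorm, which makes the completion an algebra.\<close>

lemma partition_algebra_generators:
  assumes "admissible n X"
  shows "selfadjoint_generators (partition_algebra n X) n (partition_gen n X)"
proof -
  let ?F = "free_alg n" and ?J = "relator_ideal n X" and ?Q = "universal_star_algebra n X"
  let ?N = "max_cstar_seminorm ?Q"
  interpret F: unital_star_algebra ?F by (rule unital_star_algebra_free)
  note J = F.star_ideal_generated_is_star_ideal[OF relators_closed[of n X], folded relator_ideal_def]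
  note quotient = F.unital_star_algebra_quotient[OF J(1,3), folded universal_star_algebra_def]
  interpret Q: unital_star_algebra ?Q by (rule quotient(1))
  have "cstar_seminorm ?Q ?N"
    using assms unfolding admissible_def by (intro Q.cstar_seminorm_max) simp
  then interpret Q: seminormed_star_algebra ?Q ?N by unfold_locales
  interpret A: unital_star_algebra "partition_algebra n X"
    unfolding partition_algebra_def by (rule Q.unital_star_algebra_completion(1))
  have gen: "?J +>\<^bsub>?F\<^esub> star ?F (free_u i j) = ?J +>\<^bsub>?F\<^esub> free_u i j" if "i \<in> {1..n}" "j \<in> {1..n}" for i j
  proof -
    have c: "free_u i j \<in> carrier ?F" "star ?F (free_u i j) \<in> carrier ?F"
      by (rule free_gen_in_free_alg[OF that], rule F.star_closed[OF free_gen_in_free_alg[OF that]])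
    have "free_u i j - star ?F (free_u i j) \<in> ?J"
      using J(2) that unfolding relators_def by blast
    also have "free_u i j - star ?F (free_u i j) = free_u i j \<ominus>\<^bsub>?F\<^esub> star ?F (free_u i j)"
      by (rule free_star_algebra_minus[OF c, symmetric])
    finally show ?thesis
      using F.quotient_eq_iff_same_a_r_cos[OF J(1) c] by simp
  qed
  show ?thesis
  proof (intro selfadjoint_generators.intro selfadjoint_generators_axioms.intro)
    show "unital_star_algebra (partition_algebra n X)" by unfold_locales
    fix i j assume ij: "i \<in> {1..n}" "j \<in> {1..n}"
    note c = free_gen_in_free_alg[OF ij]
    show "partition_gen n X i j \<in> carrier (partition_algebra n X)"
      unfolding partition_gen_def partition_algebra_def
      by (intro Q.unital_star_algebra_completion(2) quotient(2) c)
    show "star (partition_algebra n X) (partition_gen n X i j) = partition_gen n X i j"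
      unfolding partition_gen_def partition_algebra_def
      using Q.unital_star_algebra_completion(3)[OF quotient(2)[OF c]] quotient(3)[OF c] gen[OF ij]
      by simp
  qed
qed

lemma H_set_iff:
  assumes "p \<in> Part k l"
  shows "p \<in> H_set n X \<longleftrightarrow> fulfills_R (partition_algebra n X) n (partition_gen n X) k l p"
  using assms Part_unique[OF assms] unfolding H_set_def by blast

theorem theorem2p8:
  fixes n k l k' l' :: nat
    and X :: "point set set set"
    and p q :: "point set set"
  assumes "n \<ge> 1"
    and "admissible n X"
    and "p \<in> Part k l"
    and "q \<in> Part k' l'"
  shows "id_part \<in> H_set n X
    \<and> (p \<in> H_set n X \<and> q \<in> H_set n X \<longrightarrow> tensor_part k l p q \<in> H_set n X)
    \<and> (p \<in> H_set n X \<and> q \<in> H_set n X \<and> l = k' \<longrightarrow> compose_part k l' q p \<in> H_set n X)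
    \<and> (p \<in> H_set n X \<longrightarrow> reflection k l p \<in> H_set n X)
    \<and> (cap_part \<in> H_set n X \<and> cup_part \<in> H_set n X \<longrightarrow> p \<in> H_set n X \<longrightarrow> involution p \<in> H_set n X)"
proof -
  interpret selfadjoint_generators "partition_algebra n X" n "partition_gen n X"
    by (rule partition_algebra_generators[OF assms(2)])
  note p = assms(3) and q = assms(4)
  note H = H_set_iff[OF id_part_in_Part] H_set_iff[OF cap_part_in_Part] H_set_iff[OF cup_part_in_Part]
    H_set_iff[OF p] H_set_iff[OF q] H_set_iff[OF tensor_part_in_Part[OF p q]]
    H_set_iff[OF compose_part_in_Part] H_set_iff[OF reflection_in_Part[OF p]]
    H_set_iff[OF involution_in_Part[OF p]]
  show ?thesis
    unfolding H
  proof (intro conjI impI; (elim conjE)?)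
    show "fulfills_R (partition_algebra n X) n (partition_gen n X) 1 1 id_part"
      by (rule fulfills_R_id_part)
  next
    assume "fulfills_R (partition_algebra n X) n (partition_gen n X) k l p"
      and "fulfills_R (partition_algebra n X) n (partition_gen n X) k' l' q"
    then show "fulfills_R (partition_algebra n X) n (partition_gen n X) (k + k') (l + l') (tensor_part k l p q)"
      by (rule fulfills_R_tensor_part[OF p])
  next
    assume "fulfills_R (partition_algebra n X) n (partition_gen n X) k l p"
      and "fulfills_R (partition_algebra n X) n (partition_gen n X) k' l' q" and "l = k'"
    then show "fulfills_R (partition_algebra n X) n (partition_gen n X) k l' (compose_part k l' q p)"
      using fulfills_R_compose_part[OF assms(1) p, of q l'] q by simp
  next
    assume "fulfills_R (partition_algebra n X) n (partition_gen n X) k l p"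
    then show "fulfills_R (partition_algebra n X) n (partition_gen n X) k l (reflection k l p)"
      by (rule fulfills_R_reflection[OF p])
  next
    assume "fulfills_R (partition_algebra n X) n (partition_gen n X) 0 2 cap_part"
      and "fulfills_R (partition_algebra n X) n (partition_gen n X) 2 0 cup_part"
      and "fulfills_R (partition_algebra n X) n (partition_gen n X) k l p"
    then show "fulfills_R (partition_algebra n X) n (partition_gen n X) l k (involution p)"
      by (rule fulfills_R_involution)
  qed
qed

end
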